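(* Let $G$ be a $5$-connected graph. If $P$ and $Q$ are any two longest paths in $G$, then $|V(P)\cap V(Q)|\ge 5$.
   Context: All graphs are finite and simple. A graph is $k$-connected if it has more than $k$ vertices and remains connected after deleting any set of fewer than $k$ vertices. The length of a path is its number of edges, and a longest path in $G$ is a path of maximum length among all paths in $G$. $V(P)$ denotes the vertex set of $P$. *)

theory Defs
  imports "Graph_Theory.Graph_Theory"
begin

(* The locale predicate graph of the AFP entry Graph_Theory describes finite simple graphs:
   finite, symmetric, loop-free digraphs without parallel arcs. The conjunct on card below
   forces verts G to be finite, so that card S < k is not vacuously true of infinite S. *)

definition k_connected :: "nat \<Rightarrow> ('a, 'b) pre_digraph \<Rightarrow> bool" where
  "k_connected k G \<longleftrightarrow>
     card (verts G) > k \<and>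
     (\<forall>S \<subseteq> verts G. card S < k \<longrightarrow> connected (G \<restriction> (verts G - S)))"

(* A path is given by its sequence of vertices, so its vertex set is set p. A path and its
   reversal count as different lists; they have the same length and the same vertex set. *)

definition longest_path :: "('a, 'b) pre_digraph \<Rightarrow> 'a vwalk \<Rightarrow> bool" where
  "longest_path G p \<longleftrightarrow>
     vpath p G \<and> (\<forall>q. vpath q G \<longrightarrow> vwalk_length q \<le> vwalk_length p)"

end

theory Submission
  imports Defs "HOL-Library.Code_Binary_Nat"
begin

text \<open>
  Let \<open>X\<close> be the set of common vertices of two longest paths \<open>P\<close> and \<open>Q\<close>, with at most four
  elements, and call the stretches into which \<open>X\<close> cuts \<open>P\<close> and \<open>Q\<close> runs. As \<open>G - X\<close> is connected,
  there is a link, a path outside \<open>P\<close> and \<open>Q\<close>, between a run of \<open>P\<close> and a run of \<open>Q\<close>. For most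
  positions of the two runs, \<open>P\<close>, \<open>Q\<close> and two copies of the link can be rearranged into two paths,
  one of which is longer than \<open>P\<close>. If a link survives this, some runs must be nonempty by a
  similar count, and connectedness of \<open>G - X\<close> yields further links from these runs to the others.
  They are again impossible, unless \<open>P\<close> and \<open>Q\<close> meet \<open>X\<close> in the same order and \<open>X\<close> has four
  elements. In that case, links join only runs whose indices are adjacent on the pentagon 0, 2, 4,
  1, 3, and no run has links to two different neighbours.

  Only finitely many patterns of runs and links arise. Each of the rearrangements is a solution of
  a linear programme, with the lengths of the runs as unknowns; it is recorded as a certificate and
  checked by simplification.
\<close>

text \<open>No single rearrangement need be longer than \<open>P\<close>, because the lengths of the
  runs are arbitrary; only a weighted sum over several words is forced to be too large. The surplus
  comes from the ends of a link: each occurs once in \<open>P\<close> and \<open>Q\<close> together,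
  but twice if two words walk along the link. The interior of a link cannot be relied on, as a link
  may be a single edge, so the counts use nodes only. Connectivity 5 enters because at most four
  common vertices leave the other vertices connected. Four common vertices in the same order are
  special because the index pairs of runs left open by a single link form a pentagon. With three
  such vertices these pairs stay within the even or the odd indices, and the count succeeds once one
  of the two classes is empty. The pentagon is connected and cannot be split like this. It has no
  triangle, however, and so two links from one run to different neighbours are disjoint and can be
  used in the same word.\<close>

section \<open>Words over segments and length certificates\<close>

text \<open>\<open>Node n\<close> stands for the vertex \<open>\<nu> n\<close>, \<open>Seg b e\<close> for the possibly empty list \<open>\<sigma> e\<close> of vertices,
  traversed backwards unless \<open>b\<close>. In all words used below, nodes and segments alternate.\<close>

datatype token = Node nat | Seg bool nat

fun block :: "(nat \<Rightarrow> 'a) \<Rightarrow> (nat \<Rightarrow> 'a list) \<Rightarrow> token \<Rightarrow> 'a list" where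
  "block \<nu> \<sigma> (Node n) = [\<nu> n]"
| "block \<nu> \<sigma> (Seg b e) = (if b then \<sigma> e else rev (\<sigma> e))"

definition realize :: "(nat \<Rightarrow> 'a) \<Rightarrow> (nat \<Rightarrow> 'a list) \<Rightarrow> token list \<Rightarrow> 'a list" where
  "realize \<nu> \<sigma> w = concat (map (block \<nu> \<sigma>) w)"

lemma realize_simps [simp]:
  "realize \<nu> \<sigma> [] = []"
  "realize \<nu> \<sigma> (t # w) = block \<nu> \<sigma> t @ realize \<nu> \<sigma> w"
  "realize \<nu> \<sigma> (v @ w) = realize \<nu> \<sigma> v @ realize \<nu> \<sigma> w"
  by (simp_all add: realize_def)

fun flip_token :: "token \<Rightarrow> token" where
  "flip_token (Node n) = Node n"
| "flip_token (Seg b e) = Seg (\<not> b) e"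

definition flip :: "token list \<Rightarrow> token list" where
  "flip w = rev (map flip_token w)"

lemma block_flip_token: "block \<nu> \<sigma> (flip_token t) = rev (block \<nu> \<sigma> t)"
  by (cases t) auto

lemma realize_flip: "realize \<nu> \<sigma> (flip w) = rev (realize \<nu> \<sigma> w)"
  by (induction w) (auto simp: flip_def block_flip_token)

fun nodes_of :: "token list \<Rightarrow> nat list" where
  "nodes_of [] = []"
| "nodes_of (Node n # w) = n # nodes_of w"
| "nodes_of (Seg b e # w) = nodes_of w"

fun segs_of :: "token list \<Rightarrow> nat list" where
  "segs_of [] = []"
| "segs_of (Node n # w) = segs_of w"
| "segs_of (Seg b e # w) = e # segs_of w"

lemma nodes_of_append [simp]: "nodes_of (v @ w) = nodes_of v @ nodes_of w"
  by (induction v rule: nodes_of.induct) auto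

lemma in_nodes_of: "n \<in> set (nodes_of w) \<longleftrightarrow> Node n \<in> set w"
  by (induction w rule: nodes_of.induct) auto

lemma in_segs_of: "e \<in> set (segs_of w) \<longleftrightarrow> (\<exists>b. Seg b e \<in> set w)"
  by (induction w rule: segs_of.induct) auto

lemma length_realize:
  "length (realize \<nu> \<sigma> w) = length (nodes_of w) + (\<Sum>e\<leftarrow>segs_of w. length (\<sigma> e))"
  by (induction w rule: nodes_of.induct) auto

text \<open>Consecutive pieces share a node, so that pieces of different tracks can be glued there.
  \<open>acc\<close> holds the current piece in reverse.\<close>

fun pieces :: "token list \<Rightarrow> token list \<Rightarrow> token list list" where
  "pieces acc [] = [rev acc]"
| "pieces acc (Node n # w) = rev (Node n # acc) # pieces [Node n] w"
| "pieces acc (Seg b e # w) = pieces (Seg b e # acc) w"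

lemma successively_glue:
  "successively E (xs @ x # ys) \<longleftrightarrow> successively E (xs @ [x]) \<and> successively E (x # ys)"
  by (auto simp: successively_append_iff)

lemma pieces_successively:
  assumes "successively E (realize \<nu> \<sigma> (rev acc @ w))" "p \<in> set (pieces acc w)"
  shows "successively E (realize \<nu> \<sigma> p)"
  using assms
proof (induction acc w rule: pieces.induct)
  case (2 acc n w)
  have "successively E (realize \<nu> \<sigma> (rev acc) @ [\<nu> n])" "successively E (\<nu> n # realize \<nu> \<sigma> w)"
    using 2(2) successively_glue[of E "realize \<nu> \<sigma> (rev acc)" "\<nu> n" "realize \<nu> \<sigma> w"] by simp_all
  then show ?case using 2(1,3) by auto
qed auto

lemma pieces_tokens: "p \<in> set (pieces acc w) \<Longrightarrow> set p \<subseteq> set acc \<union> set w"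
  by (induction acc w rule: pieces.induct) fastforce+

text \<open>A word is given by its segments only; \<open>route\<close> supplies nodes and directions. It must start
  with an end segment of a track, but may stop at a node.\<close>

fun leads :: "nat \<Rightarrow> nat \<Rightarrow> token list \<Rightarrow> bool" where
  "leads n e (Node m # Seg b f # w) = (n = m \<and> e = f)"
| "leads n e w = False"

fun opens :: "nat \<Rightarrow> token list \<Rightarrow> bool" where
  "opens e (Seg b f # w) = (e = f)"
| "opens e w = False"

fun follow :: "token list list \<Rightarrow> nat \<Rightarrow> nat list \<Rightarrow> token list option" where
  "follow D n [] = Some []"
| "follow D n (e # es) =
     (case find (leads n e) D of
        None \<Rightarrow> None
      | Some p \<Rightarrow> (case last p of
          Node m \<Rightarrow> map_option ((@) (tl p)) (follow D m es)
        | Seg b f \<Rightarrow> if es = [] then Some (tl p) else None))"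

fun route :: "token list list \<Rightarrow> nat list \<Rightarrow> token list option" where
  "route D [] = None"
| "route D (e # es) =
     (case find (opens e) D of
        None \<Rightarrow> None
      | Some p \<Rightarrow> (case last p of
          Node m \<Rightarrow> map_option ((@) p) (follow D m es)
        | Seg b f \<Rightarrow> None))"

lemma leadsD: "leads n e p \<Longrightarrow> \<exists>b w. p = Node n # Seg b e # w"
  by (induction n e p rule: leads.induct) auto

lemma opensD: "opens e p \<Longrightarrow> p \<noteq> []"
  by (cases p) auto

lemma follow_sound:
  assumes "\<And>p. p \<in> set D \<Longrightarrow> successively E (realize \<nu> \<sigma> p)" "follow D n es = Some w"
  shows "successively E (realize \<nu> \<sigma> (Node n # w)) \<and> set w \<subseteq> \<Union> (set ` set D)"
  using assms(2)
proof (induction es arbitrary: n w)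
  case (Cons e es)
  obtain p where p: "find (leads n e) D = Some p"
    using Cons.prems by (auto split: option.splits)
  then have pD: "p \<in> set D" and "leads n e p"
    by (auto simp: find_Some_iff)
  then obtain b v where pv: "p = Node n # Seg b e # v" using leadsD by blast
  have walk_p: "successively E (realize \<nu> \<sigma> p)" by (rule assms(1)[OF pD])
  show ?case
  proof (cases "last p")
    case (Node m)
    then obtain w' where w': "follow D m es = Some w'" and w: "w = tl p @ w'"
      using Cons.prems p by auto
    have IH: "successively E (realize \<nu> \<sigma> (Node m # w'))" "set w' \<subseteq> \<Union> (set ` set D)"
      using Cons.IH[OF w'] by auto
    have p_eq: "p = butlast p @ [Node m]"
      using Node pv by (metis append_butlast_last_id list.distinct(1))
    have "Node n # w = butlast p @ Node m # w'"
      using w pv p_eq by (metis append.assoc append_Cons append_Nil list.sel(3))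
    moreover have "successively E (realize \<nu> \<sigma> (butlast p) @ [\<nu> m])"
      using walk_p p_eq by (metis append_Nil2 block.simps(1) realize_simps)
    ultimately have "successively E (realize \<nu> \<sigma> (Node n # w))"
      using IH(1) successively_glue[of E "realize \<nu> \<sigma> (butlast p)" "\<nu> m" "realize \<nu> \<sigma> w'"]
      by simp
    moreover have "set (tl p) \<subseteq> \<Union> (set ` set D)"
      using pD pv by fastforce
    ultimately show ?thesis using w IH(2) by auto
  next
    case (Seg b' f)
    then have "es = []" "w = tl p" using Cons.prems p by (auto split: if_splits)
    moreover have "set (tl p) \<subseteq> \<Union> (set ` set D)" using pD pv by fastforce
    ultimately show ?thesis using walk_p pv by auto
  qed
qed auto

lemma route_sound:
  assumes "\<And>p. p \<in> set D \<Longrightarrow> successively E (realize \<nu> \<sigma> p)" "route D es = Some w"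
  shows "successively E (realize \<nu> \<sigma> w) \<and> set w \<subseteq> \<Union> (set ` set D)"
proof -
  obtain e es' where es: "es = e # es'" using assms(2) by (cases es) auto
  obtain p where p: "find (opens e) D = Some p"
    using assms(2) es by (auto split: option.splits)
  then have pD: "p \<in> set D" and ne: "p \<noteq> []"
    by (auto simp: find_Some_iff dest: opensD)
  obtain m where m: "last p = Node m"
    using assms(2) es p by (auto split: token.splits)
  then obtain w' where w': "follow D m es' = Some w'" and w: "w = p @ w'"
    using assms(2) es p by auto
  have F: "successively E (realize \<nu> \<sigma> (Node m # w'))" "set w' \<subseteq> \<Union> (set ` set D)"
    using follow_sound[OF assms(1) w'] by auto
  have p_eq: "p = butlast p @ [Node m]"
    using m ne by (metis append_butlast_last_id)
  have "successively E (realize \<nu> \<sigma> (butlast p) @ [\<nu> m])"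
    using assms(1)[OF pD] p_eq by (metis append_Nil2 block.simps(1) realize_simps)
  moreover have "realize \<nu> \<sigma> w = realize \<nu> \<sigma> (butlast p) @ \<nu> m # realize \<nu> \<sigma> w'"
    using w p_eq by (metis append.assoc append_Cons append_Nil block.simps(1) realize_simps)
  ultimately have "successively E (realize \<nu> \<sigma> w)"
    using F(1) successively_glue[of E "realize \<nu> \<sigma> (butlast p)" "\<nu> m" "realize \<nu> \<sigma> w'"] by simp
  then show ?thesis using pD w F(2) by auto
qed

definition covers :: "nat list \<Rightarrow> nat \<Rightarrow> nat list \<Rightarrow> nat list \<Rightarrow> bool" where
  "covers emp a ss us \<longleftrightarrow> list_all (\<lambda>e. e \<in> set emp \<or> a \<le> count_list us e) ss"

text \<open>A certificate \<open>(a, ws)\<close> is a list \<open>ws\<close> of \<open>a + b\<close> words such that every segment of \<open>P\<close> occurs at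
  least \<open>a\<close> times in them and every segment of \<open>Q\<close> at least \<open>b\<close> times, except for the segments
  \<open>emp\<close> known to be empty, whereas the number of nodes is larger than in \<open>a\<close> copies of \<open>P\<close>
  and \<open>b\<close> copies of \<open>Q\<close>. So the words cannot all be as short as \<open>P\<close> and \<open>Q\<close>.\<close>

definition check :: "token list \<Rightarrow> token list \<Rightarrow> token list list \<Rightarrow> nat list \<Rightarrow> nat \<times> nat list list \<Rightarrow> bool" where
  "check P Q Cs emp c =
    (let (a, ws) = c; b = length ws - a;
         D = concat (map (\<lambda>T. pieces [] T @ pieces [] (flip T)) (P # Q # Cs));
         us = map (route D) ws; W = concat (map the us); ss = segs_of W in
     a \<le> length ws \<and>
     list_all (\<lambda>u. u \<noteq> None \<and> distinct (nodes_of (the u)) \<and> distinct (segs_of (the u))) us \<and>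
     a * length (nodes_of P) + b * length (nodes_of Q) < length (nodes_of W) \<and>
     distinct (segs_of P @ segs_of Q) \<and>
     covers emp a (segs_of P) ss \<and> covers emp b (segs_of Q) ss)"

text \<open>Tracks may meet in common nodes only. This reduces distinctness of the vertices of a
  word to distinctness of the numbers in it, whatever the segments contain.\<close>

locale skeleton =
  fixes E :: "'a \<Rightarrow> 'a \<Rightarrow> bool" and \<nu> :: "nat \<Rightarrow> 'a" and \<sigma> :: "nat \<Rightarrow> 'a list"
    and Ts :: "token list set"
  assumes sym: "E x y \<Longrightarrow> E y x"
    and track_walk: "T \<in> Ts \<Longrightarrow> successively E (realize \<nu> \<sigma> T)"
    and track_distinct: "T \<in> Ts \<Longrightarrow> distinct (realize \<nu> \<sigma> T)"
    and track_share: "T \<in> Ts \<Longrightarrow> T' \<in> Ts \<Longrightarrow> T \<noteq> T' \<Longrightarrow>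
      set (realize \<nu> \<sigma> T) \<inter> set (realize \<nu> \<sigma> T') \<subseteq> \<nu> ` (set (nodes_of T) \<inter> set (nodes_of T'))"
begin

lemma block_subset: "t \<in> set T \<Longrightarrow> set (block \<nu> \<sigma> t) \<subseteq> set (realize \<nu> \<sigma> T)"
  by (auto simp: realize_def)

lemma block_disjoint_same_track:
  assumes "T \<in> Ts" "s \<in> set T" "t \<in> set T" "s \<noteq> t"
  shows "set (block \<nu> \<sigma> s) \<inter> set (block \<nu> \<sigma> t) = {}"
proof -
  have *: "distinct (realize \<nu> \<sigma> T) \<Longrightarrow> s \<in> set T \<Longrightarrow> t \<in> set T \<Longrightarrow> s \<noteq> t \<Longrightarrow>
      set (block \<nu> \<sigma> s) \<inter> set (block \<nu> \<sigma> t) = {}" for T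
  proof (induction T)
    case (Cons r T)
    then show ?case using block_subset[of s T] block_subset[of t T] by auto
  qed auto
  show ?thesis using *[OF track_distinct[OF assms(1)] assms(2-4)] .
qed

text \<open>Injectivity of \<open>\<nu>\<close> need not be assumed: a vertex on two tracks comes
  from a node of both by \<open>track_share\<close>, and no track visits a vertex twice.\<close>

lemma node_inj:
  assumes "T \<in> Ts" "T' \<in> Ts" "Node m \<in> set T" "Node n \<in> set T'" "\<nu> m = \<nu> n"
  shows "m = n"
proof (cases "T = T'")
  case True
  then show ?thesis using block_disjoint_same_track[of T "Node m" "Node n"] assms by auto
next
  case False
  have "\<nu> m \<in> set (realize \<nu> \<sigma> T) \<inter> set (realize \<nu> \<sigma> T')"
    using assms block_subset[of "Node m" T] block_subset[of "Node n" T'] by auto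
  then obtain k where "Node k \<in> set T" "Node k \<in> set T'" "\<nu> k = \<nu> m"
    using track_share[OF assms(1,2) False] by (auto simp: in_nodes_of)
  then have "k = m" "k = n"
    using block_disjoint_same_track[of T "Node k" "Node m"]
      block_disjoint_same_track[of T' "Node k" "Node n"] assms by auto
  then show ?thesis by simp
qed

text \<open>A node of another track inside the segment would be a shared vertex, hence a node of
  \<open>T\<close> as well, and \<open>T\<close> would visit it twice.\<close>

lemma seg_avoids_nodes:
  assumes "T \<in> Ts" "T' \<in> Ts" "Seg b e \<in> set T" "Node n \<in> set T'"
  shows "\<nu> n \<notin> set (\<sigma> e)"
proof
  assume v: "\<nu> n \<in> set (\<sigma> e)"
  obtain k where k: "Node k \<in> set T" "\<nu> k = \<nu> n"
  proof (cases "T = T'")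
    case True
    then show ?thesis using that assms by auto
  next
    case False
    have "\<nu> n \<in> set (realize \<nu> \<sigma> T) \<inter> set (realize \<nu> \<sigma> T')"
      using assms v block_subset[of "Seg b e" T] block_subset[of "Node n" T']
      by (auto split: if_splits)
    then show ?thesis using track_share[OF assms(1,2) False] that by (auto simp: in_nodes_of)
  qed
  show False
    using block_disjoint_same_track[OF assms(1) k(1) assms(3)] k(2) v by auto
qed

lemma seg_disjoint:
  assumes "T \<in> Ts" "T' \<in> Ts" "Seg b e \<in> set T" "Seg b' f \<in> set T'" "e \<noteq> f"
  shows "set (\<sigma> e) \<inter> set (\<sigma> f) = {}"
proof (cases "T = T'")
  case True
  then show ?thesis
    using block_disjoint_same_track[of T "Seg b e" "Seg b' f"] assms by (auto split: if_splits)
next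
  case False
  show ?thesis
  proof (rule ccontr)
    assume "\<not> ?thesis"
    then obtain v where v: "v \<in> set (\<sigma> e)" "v \<in> set (\<sigma> f)" by auto
    then have "v \<in> set (realize \<nu> \<sigma> T) \<inter> set (realize \<nu> \<sigma> T')"
      using assms block_subset[of "Seg b e" T] block_subset[of "Seg b' f" T']
      by (auto split: if_splits)
    then obtain k where "Node k \<in> set T" "\<nu> k = v"
      using track_share[OF assms(1,2) False] by (auto simp: in_nodes_of)
    then show False using seg_avoids_nodes[OF assms(1,1,3)] v by auto
  qed
qed

lemma seg_distinct:
  assumes "T \<in> Ts" "Seg b e \<in> set T"
  shows "distinct (\<sigma> e)"
proof -
  have "distinct (block \<nu> \<sigma> (Seg b e))"
    using assms(2) track_distinct[OF assms(1)] unfolding realize_def distinct_concat_iff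
    by (metis image_eqI list.set_map)
  then show ?thesis by (auto split: if_splits)
qed

lemma word_distinct:
  assumes "distinct (nodes_of w)" "distinct (segs_of w)"
    and "\<And>n. n \<in> set (nodes_of w) \<Longrightarrow> \<exists>T\<in>Ts. n \<in> set (nodes_of T)"
    and "\<And>e. e \<in> set (segs_of w) \<Longrightarrow> \<exists>T\<in>Ts. e \<in> set (segs_of T)"
  shows "distinct (realize \<nu> \<sigma> w)"
  using assms
proof (induction w rule: nodes_of.induct)
  case (2 n w)
  obtain T where T: "T \<in> Ts" "Node n \<in> set T" using 2(4)[of n] by (auto simp: in_nodes_of)
  have "\<nu> n \<notin> set (block \<nu> \<sigma> t)" if t: "t \<in> set w" for t
  proof (cases t)
    case (Node m)
    then obtain T' where "T' \<in> Ts" "Node m \<in> set T'" "m \<noteq> n"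
      using 2(2) 2(4)[of m] t by (auto simp: in_nodes_of)
    then show ?thesis using node_inj[OF T(1) _ T(2)] Node by auto
  next
    case (Seg b e)
    then obtain T' b' where "T' \<in> Ts" "Seg b' e \<in> set T'"
      using 2(5)[of e] t by (auto simp: in_segs_of)
    then show ?thesis using seg_avoids_nodes[OF _ T(1) _ T(2)] Seg by (auto split: if_splits)
  qed
  then have "\<nu> n \<notin> set (realize \<nu> \<sigma> w)" by (auto simp: realize_def)
  then show ?case using 2 by auto
next
  case (3 b e w)
  obtain T b' where T: "T \<in> Ts" "Seg b' e \<in> set T" using 3(5)[of e] by (auto simp: in_segs_of)
  have "set (\<sigma> e) \<inter> set (block \<nu> \<sigma> t) = {}" if t: "t \<in> set w" for t
  proof (cases t)
    case (Node m)
    then obtain T' where "T' \<in> Ts" "Node m \<in> set T'"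
      using 3(4)[of m] t by (auto simp: in_nodes_of)
    then show ?thesis using seg_avoids_nodes[OF T(1) _ T(2)] Node by auto
  next
    case (Seg c f)
    then have f: "f \<in> set (segs_of w)" using t by (auto simp: in_segs_of)
    then obtain T' c' where "T' \<in> Ts" "Seg c' f \<in> set T'"
      using 3(5)[of f] by (auto simp: in_segs_of)
    moreover have "f \<noteq> e" using f 3(3) by auto
    ultimately show ?thesis using seg_disjoint[OF T(1) _ T(2), of T' c' f] Seg by (auto split: if_splits)
  qed
  then have "set (\<sigma> e) \<inter> set (realize \<nu> \<sigma> w) = {}" by (auto simp: realize_def)
  then show ?case using 3 seg_distinct[OF T] by auto
qed auto

end

lemma covers_le:
  assumes "covers emp a ss us" "distinct ss" "\<And>e. e \<in> set emp \<Longrightarrow> g e = (0::nat)"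
  shows "a * (\<Sum>e\<leftarrow>ss. g e) \<le> (\<Sum>e\<in>set ss. count_list us e * g e)"
proof -
  have "a * (\<Sum>e\<leftarrow>ss. g e) = (\<Sum>e\<in>set ss. a * g e)"
    using assms(2) by (simp add: sum_list_distinct_conv_sum_set sum_distrib_left)
  also have "\<dots> \<le> (\<Sum>e\<in>set ss. count_list us e * g e)"
  proof (rule sum_mono)
    fix e assume "e \<in> set ss"
    then have "e \<in> set emp \<or> a \<le> count_list us e"
      using assms(1) by (auto simp: covers_def list_all_iff)
    then show "a * g e \<le> count_list us e * g e" using assms(3) by auto
  qed
  finally show ?thesis .
qed

lemma check_sound:
  assumes "skeleton E \<nu> \<sigma> (set (P # Q # Cs))"
    and maximal: "\<And>w. successively E w \<Longrightarrow> distinct w \<Longrightarrow> length w \<le> N"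
    and "length (realize \<nu> \<sigma> P) = N" "length (realize \<nu> \<sigma> Q) = N"
    and emp: "\<And>e. e \<in> set emp \<Longrightarrow> \<sigma> e = []"
  shows "\<not> check P Q Cs emp c"
proof
  assume check: "check P Q Cs emp c"
  interpret skeleton E \<nu> \<sigma> "set (P # Q # Cs)" by fact
  obtain a ws where c: "c = (a, ws)" by fastforce
  define D where "D = concat (map (\<lambda>T. pieces [] T @ pieces [] (flip T)) (P # Q # Cs))"
  define us where "us = map the (map (route D) ws)"
  define b where "b = length ws - a"
  define ss where "ss = segs_of (concat us)"
  note check' = check[unfolded check_def c prod.case Let_def, folded D_def b_def us_def, folded ss_def]
  have le: "a \<le> length ws" and
    words: "\<And>w. w \<in> set ws \<Longrightarrow> \<exists>u. route D w = Some u \<and> distinct (nodes_of u) \<and> distinct (segs_of u)" and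
    nodes: "a * length (nodes_of P) + b * length (nodes_of Q) < length (nodes_of (concat us))" and
    dist: "distinct (segs_of P @ segs_of Q)" and
    cov: "covers emp a (segs_of P) ss" "covers emp b (segs_of Q) ss"
    using check' by (auto simp: list_all_iff)
  have D_walk: "successively E (realize \<nu> \<sigma> p)" if p_in: "p \<in> set D" for p
  proof -
    obtain T where T: "T \<in> set (P # Q # Cs)" and p: "p \<in> set (pieces [] T) \<or> p \<in> set (pieces [] (flip T))"
      using p_in unfolding D_def set_concat set_map image_image set_append by blast
    have "successively E (realize \<nu> \<sigma> (flip T))"
      using track_walk[OF T] sym unfolding realize_flip successively_rev
      by (metis (no_types, lifting) successively_mono)
    then show ?thesis
      using p track_walk[OF T] pieces_successively[of E \<nu> \<sigma> "[]"] by auto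
  qed
  have flip_flip: "flip_token (flip_token t) = t" for t by (cases t) auto
  have D_tokens: "\<exists>T\<in>set (P # Q # Cs). t \<in> set T \<or> flip_token t \<in> set T"
    if p_in: "p \<in> set D" and t_in: "t \<in> set p" for p t
  proof -
    obtain T where T: "T \<in> set (P # Q # Cs)" and p: "p \<in> set (pieces [] T) \<or> p \<in> set (pieces [] (flip T))"
      using p_in unfolding D_def set_concat set_map image_image set_append by blast
    then have "t \<in> set T \<or> t \<in> set (flip T)"
      using pieces_tokens[of p "[]" T] pieces_tokens[of p "[]" "flip T"] t_in by auto
    moreover have "flip_token t \<in> set T" if "t \<in> set (flip T)"
      using that flip_flip by (auto simp: flip_def)
    ultimately show ?thesis using T by blast
  qed
  have tokens: "\<exists>T\<in>set (P # Q # Cs). t \<in> set T \<or> flip_token t \<in> set T"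
    if "set u \<subseteq> \<Union> (set ` set D)" "t \<in> set u" for t u
    using that D_tokens by blast
  have short: "length (realize \<nu> \<sigma> u) \<le> N" if u: "u \<in> set us" for u
  proof -
    obtain w where "w \<in> set ws" "u = the (route D w)" using u by (auto simp: us_def)
    then have r: "route D w = Some u" and d: "distinct (nodes_of u)" "distinct (segs_of u)"
      using words by force+
    have walk: "successively E (realize \<nu> \<sigma> u)" and tk: "set u \<subseteq> \<Union> (set ` set D)"
      using route_sound[OF D_walk r] by auto
    have "distinct (realize \<nu> \<sigma> u)"
    proof (rule word_distinct[OF d])
      fix n assume "n \<in> set (nodes_of u)"
      then have "\<exists>T\<in>set (P # Q # Cs). Node n \<in> set T"
        using tokens[OF tk, of "Node n"] by (simp add: in_nodes_of)
      then show "\<exists>T\<in>set (P # Q # Cs). n \<in> set (nodes_of T)"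
        by (simp add: in_nodes_of)
    next
      fix e assume "e \<in> set (segs_of u)"
      then obtain c where "Seg c e \<in> set u" by (auto simp: in_segs_of)
      then obtain T where "T \<in> set (P # Q # Cs)" "Seg c e \<in> set T \<or> Seg (\<not> c) e \<in> set T"
        using tokens[OF tk, of "Seg c e"] by (metis flip_token.simps(2))
      then show "\<exists>T\<in>set (P # Q # Cs). e \<in> set (segs_of T)" by (metis in_segs_of)
    qed
    then show ?thesis using maximal walk by blast
  qed
  let ?g = "\<lambda>e. length (\<sigma> e)"
  \<comment> \<open>The total length of the words is computed twice: from above as at most
    \<open>N\<close> for each word, from below by its nodes and segments.\<close>
  have "length (realize \<nu> \<sigma> (concat us)) = (\<Sum>u\<leftarrow>us. length (realize \<nu> \<sigma> u))"
    by (induction us) auto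
  also have "\<dots> \<le> (\<Sum>u\<leftarrow>us. N)" by (rule sum_list_mono) (rule short)
  also have "\<dots> = length us * N" by (induction us) auto
  also have "\<dots> = (a + b) * N" using le by (simp add: us_def b_def)
  also have "\<dots> = a * (length (nodes_of P) + (\<Sum>e\<leftarrow>segs_of P. ?g e)) +
      b * (length (nodes_of Q) + (\<Sum>e\<leftarrow>segs_of Q. ?g e))"
    using assms(3,4) by (simp add: length_realize algebra_simps)
  finally have upper: "length (nodes_of (concat us)) + (\<Sum>e\<leftarrow>ss. ?g e) \<le> \<dots>"
    by (simp add: length_realize ss_def)
  have "a * (\<Sum>e\<leftarrow>segs_of P. ?g e) + b * (\<Sum>e\<leftarrow>segs_of Q. ?g e)
      \<le> (\<Sum>e\<in>set (segs_of P). count_list ss e * ?g e) + (\<Sum>e\<in>set (segs_of Q). count_list ss e * ?g e)"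
    using covers_le[OF cov(1), of ?g] covers_le[OF cov(2), of ?g] dist emp by (auto intro!: add_mono)
  also have "\<dots> = (\<Sum>e\<in>set (segs_of P) \<union> set (segs_of Q). count_list ss e * ?g e)"
    using dist by (subst sum.union_disjoint) auto
  \<comment> \<open>Segments of connectors can only add to the sum.\<close>
  also have "\<dots> \<le> (\<Sum>e\<in>set (segs_of P) \<union> set (segs_of Q) \<union> set ss. count_list ss e * ?g e)"
    by (rule sum_mono2) auto
  also have "\<dots> = (\<Sum>e\<in>set ss. count_list ss e * ?g e)"
    by (rule sum.mono_neutral_right) (auto simp: count_notin)
  also have "\<dots> = (\<Sum>e\<leftarrow>ss. ?g e)"
    by (simp add: sum_list_map_eq_sum_count)
  finally show False using upper nodes by (simp add: algebra_simps)
qed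

section \<open>Runs and links of two longest paths\<close>

text \<open>Empty runs are kept, so that run \<open>s\<close> always follows the first
  \<open>s\<close> common vertices and a pattern does not depend on which runs are empty.\<close>

fun runs :: "'a set \<Rightarrow> 'a list \<Rightarrow> 'a list list" where
  "runs X [] = [[]]"
| "runs X (x # xs) =
     (if x \<in> X then [] # runs X xs else (x # hd (runs X xs)) # tl (runs X xs))"

lemma runs_not_Nil [simp]: "runs X ys \<noteq> []"
  by (cases ys) auto

lemma length_runs: "length (runs X ys) = Suc (length (filter (\<lambda>v. v \<in> X) ys))"
  by (induction ys) auto

lemma concat_runs: "concat (runs X ys) = filter (\<lambda>v. v \<notin> X) ys"
proof (induction ys)
  case (Cons y ys)
  then show ?case by (cases "runs X ys") auto
qed auto

lemma runs_disjoint: "set ys \<inter> X = {} \<Longrightarrow> runs X ys = [ys]"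
  by (induction ys) auto

lemma runs_append_Cons:
  "set a \<inter> X = {} \<Longrightarrow> v \<in> X \<Longrightarrow> runs X (a @ v # ys) = a # runs X ys"
  by (induction a) auto

lemma filter_mem_eq_ConsD:
  assumes "filter (\<lambda>v. v \<in> X) ys = v # vs"
  obtains a zs where "ys = a @ v # zs" "set a \<inter> X = {}" "v \<in> X" "filter (\<lambda>v. v \<in> X) zs = vs"
  using assms by (fastforce simp: filter_eq_Cons_iff)

lemma in_runs:
  "v \<in> set ys - X \<longleftrightarrow> (\<exists>s \<le> length (filter (\<lambda>v. v \<in> X) ys). v \<in> set (runs X ys ! s))"
proof -
  have "v \<in> set ys - X \<longleftrightarrow> v \<in> set (concat (runs X ys))"
    by (auto simp: concat_runs)
  also have "\<dots> \<longleftrightarrow> (\<exists>r\<in>set (runs X ys). v \<in> set r)" by auto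
  also have "\<dots> \<longleftrightarrow> (\<exists>s<length (runs X ys). v \<in> set (runs X ys ! s))"
    by (metis in_set_conv_nth)
  finally show ?thesis by (simp add: length_runs less_Suc_eq_le)
qed

lemma distinct_runs:
  assumes "distinct ys" "s \<le> length (filter (\<lambda>v. v \<in> X) ys)"
  shows "distinct (runs X ys ! s)"
proof -
  have "distinct (concat (runs X ys))" using assms(1) by (simp add: concat_runs)
  then show ?thesis
    using assms(2) by (simp add: distinct_concat_iff length_runs less_Suc_eq_le)
qed

lemma distinct_concat_nth_disjoint:
  assumes "distinct (concat xss)" "i < length xss" "j < length xss" "i \<noteq> j"
  shows "set (xss ! i) \<inter> set (xss ! j) = {}"
  using assms
proof (induction xss arbitrary: i j)
  case (Cons xs xss)
  have *: "set xs \<inter> set (xss ! k) = {}" if "k < length xss" for k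
    using Cons.prems(1) nth_mem[OF that] by auto
  show ?case
    using Cons.prems Cons.IH[of "i - 1" "j - 1"] *[of "i - 1"] *[of "j - 1"]
    by (cases i; cases j) auto
qed auto

lemma runs_unique:
  assumes "distinct ys" "s \<le> length (filter (\<lambda>v. v \<in> X) ys)" "s' \<le> length (filter (\<lambda>v. v \<in> X) ys)"
    and "v \<in> set (runs X ys ! s)" "v \<in> set (runs X ys ! s')"
  shows "s = s'"
proof (rule ccontr)
  assume "s \<noteq> s'"
  moreover have "distinct (concat (runs X ys))" using assms(1) by (simp add: concat_runs)
  ultimately have "set (runs X ys ! s) \<inter> set (runs X ys ! s') = {}"
    using distinct_concat_nth_disjoint assms(2,3) by (metis length_runs less_Suc_eq_le)
  then show False using assms(4,5) by auto
qed

text \<open>Part \<open>r\<close> of run \<open>s\<close>, as cut by the attached nodes, is segment \<open>10 * s + r\<close> on \<open>P\<close> and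
  \<open>100 + 10 * s + r\<close> on \<open>Q\<close>; the \<open>i\<close>-th connector is segment \<open>200 + i\<close>. The nodes \<open>0..3\<close> are
  the common vertices, the nodes \<open>5..8\<close> the ends of links.\<close>

fun cells :: "nat \<Rightarrow> nat list \<Rightarrow> token list" where
  "cells b [] = [Seg True b]"
| "cells b (v # vs) = Seg True b # Node v # cells (Suc b) vs"

fun track :: "nat \<Rightarrow> (nat \<Rightarrow> nat list) \<Rightarrow> nat \<Rightarrow> nat list \<Rightarrow> token list" where
  "track b f s [] = cells (b + 10 * s) (f s)"
| "track b f s (x # xs) = cells (b + 10 * s) (f s) @ Node x # track b f (Suc s) xs"

lemma nodes_of_cells: "nodes_of (cells b vs) = vs"
  by (induction b vs rule: cells.induct) auto

lemma set_nodes_of_track: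
  "set (nodes_of (track b f i xs)) = set xs \<union> (\<Union>s\<le>length xs. set (f (i + s)))"
proof (induction b f i xs rule: track.induct)
  case (2 b f s x xs)
  have "{..length (x # xs)} = insert 0 (Suc ` {..length xs})"
    by (simp add: atMost_Suc_eq_insert_0)
  then show ?case using 2 by (auto simp: nodes_of_cells)
qed (auto simp: nodes_of_cells)

lemma realize_cells:
  assumes "filter (\<lambda>v. v \<in> A) ys = map \<nu> vs"
    and "\<And>r. r \<le> length vs \<Longrightarrow> \<sigma> (b + r) = runs A ys ! r"
  shows "realize \<nu> \<sigma> (cells b vs) = ys"
  using assms
proof (induction b vs arbitrary: ys rule: cells.induct)
  case (1 b)
  have "set ys \<inter> A = {}" using 1(1) by (auto simp: filter_empty_conv)
  then show ?case using 1(2)[of 0] by (simp add: runs_disjoint)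
next
  case (2 b v vs)
  obtain a zs where ys: "ys = a @ \<nu> v # zs" "set a \<inter> A = {}" "\<nu> v \<in> A"
    "filter (\<lambda>v. v \<in> A) zs = map \<nu> vs"
    using filter_mem_eq_ConsD[of A ys "\<nu> v" "map \<nu> vs"] 2(2) by auto
  have r: "runs A ys = a # runs A zs" using ys by (simp add: runs_append_Cons)
  have "realize \<nu> \<sigma> (cells (Suc b) vs) = zs"
  proof (rule 2(1))
    show "\<sigma> (Suc b + k) = runs A zs ! k" if "k \<le> length vs" for k
      using 2(3)[of "Suc k"] that r by simp
  qed (rule ys(4))
  then show ?case using 2(3)[of 0] r ys(1) by simp
qed

lemma realize_track:
  assumes "filter (\<lambda>v. v \<in> X) ys = map \<nu> xs"
    and "\<And>s. s \<le> length xs \<Longrightarrow> realize \<nu> \<sigma> (cells (b + 10 * (i + s)) (f (i + s))) = runs X ys ! s"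
  shows "realize \<nu> \<sigma> (track b f i xs) = ys"
  using assms
proof (induction b f i xs arbitrary: ys rule: track.induct)
  case (1 b f i)
  have "set ys \<inter> X = {}" using 1(1) by (auto simp: filter_empty_conv)
  then show ?case using 1(2)[of 0] by (simp add: runs_disjoint)
next
  case (2 b f i x xs)
  obtain a zs where ys: "ys = a @ \<nu> x # zs" "set a \<inter> X = {}" "\<nu> x \<in> X"
    "filter (\<lambda>v. v \<in> X) zs = map \<nu> xs"
    using filter_mem_eq_ConsD[of X ys "\<nu> x" "map \<nu> xs"] 2(2) by auto
  have r: "runs X ys = a # runs X zs" using ys by (simp add: runs_append_Cons)
  have "realize \<nu> \<sigma> (track b f (Suc i) xs) = zs"
  proof (rule 2(1))
    show "realize \<nu> \<sigma> (cells (b + 10 * (Suc i + k)) (f (Suc i + k))) = runs X zs ! k"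
      if "k \<le> length xs" for k
      using 2(3)[of "Suc k"] that r by (simp add: algebra_simps)
  qed (rule ys(4))
  then show ?case using 2(3)[of 0] r ys(1) by simp
qed

type_synonym attachment = "((nat \<times> nat) \<times> nat list) list"

definition attached :: "attachment \<Rightarrow> nat \<Rightarrow> nat \<Rightarrow> nat list" where
  "attached att k s = (case map_of att (k, s) of None \<Rightarrow> [] | Some l \<Rightarrow> l)"

definition connector :: "nat \<Rightarrow> nat \<times> nat \<Rightarrow> token list" where
  "connector i uv = [Node (fst uv), Seg True (200 + i), Node (snd uv)]"

text \<open>An empty run has no attached nodes, so it consists of the single segment
  \<open>100 * k + 10 * s\<close>.\<close>

definition refuted ::
  "nat list \<Rightarrow> nat list \<Rightarrow> attachment \<Rightarrow> (nat \<times> nat) list \<Rightarrow> (nat \<times> nat) list \<Rightarrow> nat \<times> nat list list \<Rightarrow> bool"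
  where
  "refuted xs ys att cs emp c =
     check (track 0 (attached att 0) 0 xs) (track 100 (attached att 1) 0 ys)
       (map (\<lambda>i. connector i (cs ! i)) [0..<length cs])
       (map (\<lambda>(k, s). 100 * k + 10 * s) emp) c"

text \<open>This keeps what the argument needs of the graph, in a form invariant under reversing a
  path or exchanging the two. Connectivity enters only through \<open>joined\<close>;
  \<open>N\<close> counts vertices, not edges.\<close>

locale longest_pair =
  fixes E :: "'a \<Rightarrow> 'a \<Rightarrow> bool" and P Q :: "'a list" and N :: nat
  assumes sym: "E x y \<Longrightarrow> E y x"
    and walks: "successively E P" "successively E Q"
    and distinct_paths: "distinct P" "distinct Q"
    and lengths: "length P = N" "length Q = N"
    and maximal: "successively E w \<Longrightarrow> distinct w \<Longrightarrow> length w \<le> N"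
    and joined: "u \<in> set P \<union> set Q - set P \<inter> set Q \<Longrightarrow> v \<in> set P \<union> set Q - set P \<inter> set Q \<Longrightarrow>
      \<exists>w. w \<noteq> [] \<and> distinct w \<and> successively E w \<and> hd w = u \<and> last w = v \<and> set w \<inter> (set P \<inter> set Q) = {}"
    and proper: "set P - set Q \<noteq> {}" "set Q - set P \<noteq> {}"
begin

abbreviation X :: "'a set" where "X \<equiv> set P \<inter> set Q"

definition run :: "nat \<Rightarrow> nat \<Rightarrow> 'a list" where
  "run k s = runs X (if k = 0 then P else Q) ! s"

text \<open>\<open>R\<close> holds the inner vertices only; it is empty if the link is a single
  edge.\<close>

definition link :: "'a \<Rightarrow> 'a list \<Rightarrow> 'a \<Rightarrow> bool" where
  "link p R q \<longleftrightarrow> successively E (p # R @ [q]) \<and> distinct R \<and> set R \<inter> (set P \<union> set Q) = {}"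

lemma link_sym: "link p R q \<Longrightarrow> link q (rev R) p"
proof -
  assume l: "link p R q"
  have "successively E (rev (p # R @ [q]))"
    using l sym unfolding link_def successively_rev by (metis (no_types, lifting) successively_mono)
  then show ?thesis using l by (auto simp: link_def)
qed

text \<open>The ends of the links form the set \<open>A\<close>, at which the runs are cut once
  more; the resulting parts are the segments. Distinct links must be disjoint, as a word may use
  several of them.\<close>

lemma links_not_refuted:
  assumes filt: "filter (\<lambda>v. v \<in> X) P = map \<nu> xs" "filter (\<lambda>v. v \<in> X) Q = map \<nu> ys"
    and same: "set ys = set xs"
    and small: "length xs \<le> 9" "length ys \<le> 9"
    and attP: "\<And>s. s \<le> length xs \<Longrightarrow>
      filter (\<lambda>v. v \<in> A) (run 0 s) = map \<nu> (attached att 0 s) \<and> length (attached att 0 s) \<le> 9"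
    and attQ: "\<And>s. s \<le> length ys \<Longrightarrow>
      filter (\<lambda>v. v \<in> A) (run 1 s) = map \<nu> (attached att 1 s) \<and> length (attached att 1 s) \<le> 9"
    and U: "U = (\<Union>s\<le>length xs. set (attached att 0 s)) \<union> (\<Union>s\<le>length ys. set (attached att 1 s))"
    and inj: "inj_on \<nu> U"
    and links: "\<And>i u v. i < length cs \<Longrightarrow> cs ! i = (u, v) \<Longrightarrow>
      u \<in> U \<and> v \<in> U \<and> u \<noteq> v \<and> link (\<nu> u) (Rs ! i) (\<nu> v)"
    and disj: "\<And>i j. i < length cs \<Longrightarrow> j < length cs \<Longrightarrow> i \<noteq> j \<Longrightarrow> set (Rs ! i) \<inter> set (Rs ! j) = {}"
    and emp: "\<And>k s. (k, s) \<in> set emp \<Longrightarrow> k \<le> 1 \<and> s \<le> 9 \<and> run k s = []"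
  shows "\<not> refuted xs ys att cs emp c"
proof -
  \<comment> \<open>The tens digit is the run and the units digit its part, which is unambiguous
    because of the bounds by 9.\<close>
  define \<sigma> where "\<sigma> e = (if e < 100 then runs A (run 0 (e div 10)) ! (e mod 10)
    else if e < 200 then runs A (run 1 ((e - 100) div 10)) ! ((e - 100) mod 10)
    else Rs ! (e - 200))" for e
  define TP where "TP = track 0 (attached att 0) 0 xs"
  define TQ where "TQ = track 100 (attached att 1) 0 ys"
  define Cs where "Cs = map (\<lambda>i. connector i (cs ! i)) [0..<length cs]"
  have realP: "realize \<nu> \<sigma> TP = P" unfolding TP_def
  proof (rule realize_track[OF filt(1)])
    fix s assume s: "s \<le> length xs"
    have "realize \<nu> \<sigma> (cells (0 + 10 * (0 + s)) (attached att 0 (0 + s))) = run 0 s"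
    proof (rule realize_cells)
      show "filter (\<lambda>v. v \<in> A) (run 0 s) = map \<nu> (attached att 0 (0 + s))" using attP[OF s] by simp
      show "\<sigma> (0 + 10 * (0 + s) + r) = runs A (run 0 s) ! r" if "r \<le> length (attached att 0 (0 + s))" for r
        using that attP[OF s] s small(1) by (simp add: \<sigma>_def)
    qed
    then show "realize \<nu> \<sigma> (cells (0 + 10 * (0 + s)) (attached att 0 (0 + s))) = runs X P ! s"
      by (simp add: run_def)
  qed
  have realQ: "realize \<nu> \<sigma> TQ = Q" unfolding TQ_def
  proof (rule realize_track[OF filt(2)])
    fix s assume s: "s \<le> length ys"
    have "realize \<nu> \<sigma> (cells (100 + 10 * (0 + s)) (attached att 1 (0 + s))) = run 1 s"
    proof (rule realize_cells)
      show "filter (\<lambda>v. v \<in> A) (run 1 s) = map \<nu> (attached att 1 (0 + s))" using attQ[OF s] by simp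
      show "\<sigma> (100 + 10 * (0 + s) + r) = runs A (run 1 s) ! r" if "r \<le> length (attached att 1 (0 + s))" for r
        using that attQ[OF s] s small(2) by (simp add: \<sigma>_def)
    qed
    then show "realize \<nu> \<sigma> (cells (100 + 10 * (0 + s)) (attached att 1 (0 + s))) = runs X Q ! s"
      by (simp add: run_def)
  qed
  have realC: "realize \<nu> \<sigma> (connector i (cs ! i)) = \<nu> (fst (cs ! i)) # Rs ! i @ [\<nu> (snd (cs ! i))]" for i
    by (simp add: connector_def \<sigma>_def)
  have in_Cs: "T \<in> set Cs \<longleftrightarrow> (\<exists>i<length cs. T = connector i (cs ! i))" for T
    unfolding Cs_def by force
  have nodesP: "set (nodes_of TP) = set xs \<union> (\<Union>s\<le>length xs. set (attached att 0 s))"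
    and nodesQ: "set (nodes_of TQ) = set ys \<union> (\<Union>s\<le>length ys. set (attached att 1 s))"
    unfolding TP_def TQ_def by (simp_all only: set_nodes_of_track add_0)
  have lenP: "length xs = length (filter (\<lambda>v. v \<in> X) P)" and lenQ: "length ys = length (filter (\<lambda>v. v \<in> X) Q)"
    using filt by (metis length_map)+
  have onP: "\<nu> u \<in> set P - X" if "u \<in> set (attached att 0 s)" "s \<le> length xs" for u s
  proof -
    have "\<nu> u \<in> set (run 0 s)" using attP[OF that(2)] that(1) by (metis (no_types, lifting) filter_is_subset image_eqI list.set_map subsetD)
    then show ?thesis using in_runs[of "\<nu> u" P X] that(2) by (auto simp: lenP run_def)
  qed
  have onQ: "\<nu> u \<in> set Q - X" if "u \<in> set (attached att 1 s)" "s \<le> length ys" for u s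
  proof -
    have "\<nu> u \<in> set (run 1 s)" using attQ[OF that(2)] that(1) by (metis (no_types, lifting) filter_is_subset image_eqI list.set_map subsetD)
    then show ?thesis using in_runs[of "\<nu> u" Q X] that(2) by (auto simp: lenQ run_def)
  qed
  have endP: "u \<in> set (nodes_of TP)" if "u \<in> U" "\<nu> u \<in> set P" for u
    using that onQ unfolding U nodesP by blast
  have endQ: "u \<in> set (nodes_of TQ)" if "u \<in> U" "\<nu> u \<in> set Q" for u
    using that onP unfolding U nodesQ by blast
  have onPQ: "\<nu> u \<in> set P \<union> set Q" if "u \<in> U" for u
    using that onP onQ unfolding U by blast
  let ?S = "\<lambda>T T'. set (realize \<nu> \<sigma> T) \<inter> set (realize \<nu> \<sigma> T') \<subseteq> \<nu> ` (set (nodes_of T) \<inter> set (nodes_of T'))"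
  have "set (filter (\<lambda>v. v \<in> X) P) = X" "set (filter (\<lambda>v. v \<in> X) Q) = X" by auto
  then have X: "X = \<nu> ` set xs" "X = \<nu> ` set ys" unfolding filt by simp_all
  have nodesC: "set (nodes_of (connector i (cs ! i))) = {fst (cs ! i), snd (cs ! i)}" for i
    by (auto simp: connector_def)
  have l: "fst (cs ! i) \<in> U" "snd (cs ! i) \<in> U" "fst (cs ! i) \<noteq> snd (cs ! i)"
    "successively E (realize \<nu> \<sigma> (connector i (cs ! i)))" "distinct (Rs ! i)"
    "set (Rs ! i) \<inter> (set P \<union> set Q) = {}" if "i < length cs" for i
    using links[OF that, of "fst (cs ! i)" "snd (cs ! i)"] by (auto simp: link_def realC)
  have \<nu>_eq: "u = v" if "\<nu> u = \<nu> v" "u \<in> U" "v \<in> U" for u v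
    using inj that by (auto dest: inj_onD)
  have sPQ: "?S TP TQ" using X same unfolding realP realQ nodesP nodesQ by auto
  have sPC: "?S TP (connector i (cs ! i))" if "i < length cs" for i
    unfolding realP realC nodesC using endP l[OF that] by auto
  have sQC: "?S TQ (connector i (cs ! i))" if "i < length cs" for i
    unfolding realQ realC nodesC using endQ l[OF that] by auto
  have off: "\<nu> u \<notin> set (Rs ! i)" if "u \<in> U" "i < length cs" for u i
    using onPQ[OF that(1)] l(6)[OF that(2)] by auto
  have sCC: "?S (connector i (cs ! i)) (connector j (cs ! j))" if ij: "i < length cs" "j < length cs" "i \<noteq> j" for i j
  proof
    fix v assume "v \<in> set (realize \<nu> \<sigma> (connector i (cs ! i))) \<inter> set (realize \<nu> \<sigma> (connector j (cs ! j)))"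
    then have v: "v \<in> {\<nu> (fst (cs ! i)), \<nu> (snd (cs ! i))} \<union> set (Rs ! i)"
      "v \<in> {\<nu> (fst (cs ! j)), \<nu> (snd (cs ! j))} \<union> set (Rs ! j)"
      unfolding realC by auto
    have "v \<notin> set (Rs ! i)" "v \<notin> set (Rs ! j)"
      using v off l(1,2)[OF ij(1)] l(1,2)[OF ij(2)] disj[OF ij] ij by auto
    obtain a where a: "a \<in> {fst (cs ! i), snd (cs ! i)}" "v = \<nu> a"
      using v(1) \<open>v \<notin> set (Rs ! i)\<close> by blast
    obtain b where b: "b \<in> {fst (cs ! j), snd (cs ! j)}" "v = \<nu> b"
      using v(2) \<open>v \<notin> set (Rs ! j)\<close> by blast
    have "a = b" using a b \<nu>_eq l(1,2)[OF ij(1)] l(1,2)[OF ij(2)] by auto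
    then show "v \<in> \<nu> ` (set (nodes_of (connector i (cs ! i))) \<inter> set (nodes_of (connector j (cs ! j))))"
      unfolding nodesC using a b by blast
  qed
  have "skeleton E \<nu> \<sigma> (set (TP # TQ # Cs))"
  proof
    fix T assume "T \<in> set (TP # TQ # Cs)"
    then consider "T = TP" | "T = TQ" | i where "i < length cs" "T = connector i (cs ! i)"
      using in_Cs by auto
    then have "successively E (realize \<nu> \<sigma> T) \<and> distinct (realize \<nu> \<sigma> T)"
    proof cases
      case (3 i)
      show ?thesis
        using l[OF 3(1)] \<nu>_eq[of "fst (cs ! i)" "snd (cs ! i)"] onPQ[of "fst (cs ! i)"] onPQ[of "snd (cs ! i)"]
        unfolding 3(2) realC by auto
    qed (simp_all add: realP realQ walks distinct_paths)
    then show "successively E (realize \<nu> \<sigma> T)" "distinct (realize \<nu> \<sigma> T)" by auto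
  next
    fix T T' assume T: "T \<in> set (TP # TQ # Cs)" "T' \<in> set (TP # TQ # Cs)" "T \<noteq> T'"
    consider "T = TP" | "T = TQ" | i where "i < length cs" "T = connector i (cs ! i)"
      using T(1) in_Cs by auto
    note c1 = this
    consider "T' = TP" | "T' = TQ" | i where "i < length cs" "T' = connector i (cs ! i)"
      using T(2) in_Cs by auto
    note c2 = this
    have comm: "?S T T'" if "?S T' T" using that by (simp add: Int_commute)
    show "?S T T'"
    proof (cases rule: c1)
      case 1
      then show ?thesis using T(3) sPQ sPC by (cases rule: c2) auto
    next
      case 2
      then show ?thesis using T(3) sPQ sQC comm by (cases rule: c2) auto
    next
      case (3 i)
      show ?thesis
      proof (cases rule: c2)
        case (3 j)
        then have "i \<noteq> j" using T(3) \<open>T = connector i (cs ! i)\<close> by auto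
        then show ?thesis using sCC 3 \<open>i < length cs\<close> \<open>T = connector i (cs ! i)\<close> by simp
      qed (use 3 sPC sQC comm in auto)
    qed
  qed (rule sym)
  moreover have "\<sigma> e = []" if e: "e \<in> set (map (\<lambda>(k, s). 100 * k + 10 * s) emp)" for e
  proof -
    obtain k s where ks: "(k, s) \<in> set emp" "e = 100 * k + 10 * s" using e by auto
    have "k \<le> 1" "s \<le> 9" "run k s = []" using emp[OF ks(1)] by auto
    then show ?thesis unfolding ks(2) by (cases "k = 0") (auto simp: \<sigma>_def le_Suc_eq)
  qed
  ultimately show ?thesis
    unfolding refuted_def TP_def[symmetric] TQ_def[symmetric] Cs_def[symmetric]
    by (intro check_sound[where E = E and \<nu> = \<nu> and \<sigma> = \<sigma> and N = N])
      (auto simp: realP realQ lengths maximal)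
qed

end

section \<open>Certificates for a single link\<close>

definition segments :: "nat \<Rightarrow> (nat \<times> nat) list" where
  "segments t = List.product [0, 1] [0..<Suc t]"

text \<open>With this order every unordered pair of runs needs one certificate only;
  \<open>link_sym\<close> gives the other direction.\<close>

definition before :: "nat \<times> nat \<Rightarrow> nat \<times> nat \<Rightarrow> bool" where
  "before c d \<longleftrightarrow> fst c < fst d \<or> fst c = fst d \<and> snd c < snd d"

text \<open>The runs in \<open>lab\<close> have no links to the other runs, and a link between \<open>P\<close> and \<open>Q\<close> is only possible
  if there are vertices both in the runs in \<open>lab\<close> and in the other runs. By connectedness, there
  is no such link.\<close>

definition separation ::
  "nat list \<Rightarrow> nat list \<Rightarrow> (nat \<times> nat) list \<Rightarrow> (nat \<times> nat list list) list \<Rightarrow> bool" where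
  "separation xs ys lab tab \<longleftrightarrow> (let S = segments (length xs) in
     list_all2 (\<lambda>(c, d). refuted xs ys [(c, [5]), (d, [6])] [(5, 6)]
         (if (c \<in> set lab) = (d \<in> set lab) then filter (\<lambda>e. (e \<in> set lab) \<noteq> (c \<in> set lab)) S else []))
       (filter (\<lambda>(c, d). before c d \<and> (fst c \<noteq> fst d \<or> (c \<in> set lab) \<noteq> (d \<in> set lab)))
         (List.product S S)) tab)"

text \<open>\<open>code_simp\<close> relies on \<open>Code_Binary_Nat\<close> here: otherwise it compares segment numbers in unary.\<close>

lemma separation_Nil: "\<exists>tab. separation [] [] [] tab"
proof
  show "separation [] [] []
   [(1,[[0,200,100],[1,200,101]])]"
    by code_simp
qed

lemma separation_0: "\<exists>tab. separation [0] [0] [] tab"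
proof
  show "separation [0] [0] []
   [(1,[[0,200,101,10],[100,200,1,110]]), (1,[[0,200,110,10],[100,1,200,111]]),
    (1,[[0,10,200,100],[11,200,101,110]]), (1,[[0,10,200,111],[11,200,110,100]])]"
    by code_simp
qed

lemma separation_01: "\<exists>tab. separation [0, 1] [0, 1] [] tab"
proof
  show "separation [0, 1] [0, 1] []
   [(1,[[0,200,101,10,20],[100,200,1,110,120]]), (1,[[0,200,110,10,20],[100,1,200,111,120]]),
    (1,[[0,200,120,10,100],[20,110,1,200,121]]), (1,[[0,101,200,11,20],[100,200,10,110,120]]),
    (1,[[0,10,200,111,20],[100,110,200,11,120]]), (1,[[0,10,200,120,20],[100,110,11,200,121]]),
    (1,[[0,10,20,200,100],[21,200,101,110,120]]), (1,[[0,10,111,200,21],[100,110,200,20,120]]),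
    (1,[[0,10,20,200,121],[21,200,120,110,100]])]"
    by code_simp
qed

text \<open>The classes are the odd and the even runs. Words without segment 200 do not walk along
  the link; they use only that its ends are vertices of their runs while all runs of the other class
  are empty.\<close>

lemma separation_012: "\<exists>tab. separation [0, 1, 2] [0, 1, 2] [(0, 1), (0, 3), (1, 1), (1, 3)] tab"
proof
  show "separation [0, 1, 2] [0, 1, 2] [(0, 1), (0, 3), (1, 1), (1, 3)]
   [(1,[[0,200,10,110,20,30],[100,1,200,11,120,130]]),
    (1,[[0,200,30,20,10,100],[31,200,1,110,120,130]]),
    (1,[[0,200,101,10,20,30],[30,120,10,1,200,100]]),
    (1,[[0,200,110,10,20,30],[100,1,200,111,120,130]]), (1,[[0,1,10,20,121],[0,200,120,10,100]]),
    (1,[[0,200,130,20,10,100],[30,120,110,1,200,131]]),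
    (1,[[0,10,200,20,120,30],[100,110,11,200,21,130]]),
    (1,[[0,101,200,11,20,30],[100,200,10,110,120,130]]),
    (1,[[0,10,11,20,30],[130,20,111,110,10]]),
    (1,[[0,10,200,120,20,30],[100,110,11,200,121,130]]),
    (1,[[0,10,11,20,30],[131,130,20,110,10]]), (1,[[0,10,20,200,30,130],[31,200,21,120,110,100]]),
    (1,[[0,10,20,21,30],[100,101,10,120,21]]),
    (1,[[0,10,111,200,21,30],[100,110,200,20,120,130]]),
    (1,[[0,10,20,21,30],[100,10,120,121,21]]),
    (1,[[0,10,20,200,130,30],[100,110,120,21,200,131]]),
    (1,[[0,10,20,30,200,100],[31,200,101,110,120,130]]),
    (1,[[0,10,111,200,30,130],[0,110,111,20,30,31]]),
    (1,[[0,10,20,121,200,31],[100,110,120,200,30,130]]),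
    (1,[[0,10,20,30,200,131],[0,110,20,130,200,31]]),
    (1,[[0,101,200,111,20,30],[100,200,110,10,120,130]]),
    (1,[[0,10,20,130,200,100],[30,120,110,101,200,131]]),
    (1,[[0,10,111,200,121,30],[100,110,200,120,20,130]]),
    (1,[[0,10,20,121,200,131],[30,130,200,120,110,100]])]"
    by code_simp
qed

lemma separation_021: "\<exists>tab. separation [0, 1, 2] [0, 2, 1] [] tab"
proof
  show "separation [0, 1, 2] [0, 2, 1] []
   [(1,[[0,200,101,10,20,30],[100,200,1,110,120,130]]),
    (1,[[0,200,110,10,20,30],[100,1,200,111,120,130]]),
    (1,[[0,200,120,20,10,100],[30,110,1,200,121,130]]),
    (1,[[0,200,130,20,110,100],[30,120,10,1,200,131]]),
    (1,[[0,101,200,11,20,30],[100,200,10,110,120,130]]),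
    (1,[[0,10,200,111,20,130],[30,120,11,200,110,100]]),
    (1,[[0,10,200,121,20,30],[100,110,120,200,11,130]]),
    (1,[[0,10,200,130,20,30],[100,110,120,11,200,131]]),
    (1,[[0,10,120,21,200,100],[30,110,101,200,20,130]]),
    (1,[[0,10,20,200,111,30],[100,110,200,21,120,130]]),
    (1,[[0,10,20,200,120,30],[100,110,21,200,121,130]]),
    (1,[[0,10,130,200,21,30],[100,110,120,20,200,131]]),
    (1,[[0,10,20,30,200,100],[31,200,101,110,120,130]]),
    (1,[[0,10,20,111,200,31],[100,110,200,30,120,130]]),
    (1,[[0,10,20,120,200,31],[100,110,30,200,121,130]]),
    (1,[[0,10,20,30,200,131],[31,200,130,120,110,100]])]"
    by code_simp
qed

text \<open>The class consists of the two runs between the common vertices 2 and 3, which the paths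
  meet in opposite order. Three words with 2 in front count \<open>P\<close> twice and
  \<open>Q\<close> once; with 1 in front it is the other way round.\<close>

lemma separation_0132: "\<exists>tab. separation [0, 1, 2, 3] [0, 1, 3, 2] [(0, 3), (1, 3)] tab"
proof
  show "separation [0, 1, 2, 3] [0, 1, 3, 2] [(0, 3), (1, 3)]
   [(1,[[0,200,30,130,120,10,100],[40,31,200,1,110,20,140]]),
    (1,[[0,200,101,10,20,30,40],[100,200,1,110,120,30,140]]),
    (1,[[0,200,110,10,20,30,40],[100,1,200,111,120,30,140]]),
    (2,[[0,1,10,120,121,40],[0,200,121,30,20,10,100],[40,121,200,1,110,20,140]]),
    (1,[[0,200,130,30,20,10,100],[40,120,110,1,200,131,140]]),
    (1,[[0,200,140,30,120,10,100],[40,30,20,110,1,200,141]]),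
    (1,[[0,10,200,30,20,120,40],[100,110,11,200,31,130,140]]),
    (1,[[0,101,200,11,20,30,40],[100,200,10,110,120,30,140]]),
    (1,[[0,10,200,111,20,30,40],[100,110,200,11,120,30,140]]),
    (1,[[0,10,200,120,20,30,40],[100,110,11,200,121,30,140]]),
    (1,[[0,10,200,130,120,20,140],[40,30,131,200,11,110,100]]),
    (2,[[0,10,11,20,140,141],[0,10,200,140,20,120,40],[40,30,140,200,11,110,100]]),
    (1,[[0,10,20,200,30,130,40],[100,110,120,31,200,21,140]]),
    (1,[[0,10,120,30,21,200,100],[40,120,110,101,200,21,140],[100,101,110,20,21,140]]),
    (1,[[0,10,111,200,21,30,40],[100,110,200,20,120,30,140]]),
    (1,[[0,10,20,200,121,30,140],[40,30,21,200,120,110,100]]),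
    (1,[[0,10,20,200,131,30,40],[100,110,120,130,200,21,140]]),
    (1,[[0,10,20,200,140,30,40],[100,110,120,30,21,200,141]]),
    (1,[[0,10,20,130,31,200,41],[100,110,120,40,200,30,140]]),
    (1,[[0,10,20,130,31,200,100],[40,120,110,101,200,30,140]]),
    (1,[[0,10,111,200,30,130,40],[100,110,200,31,120,20,140]]),
    (1,[[0,10,20,30,200,121,40],[100,110,120,200,31,130,140]]),
    (1,[[0,10,20,30,31,40],[0,10,20,131,130,31]]),
    (1,[[0,10,20,140,200,31,40],[100,110,120,130,30,200,141]]),
    (1,[[0,10,20,30,40,200,100],[41,200,101,110,120,30,140]]),
    (1,[[0,10,111,200,40,30,140],[41,40,120,111,110,100],[100,110,200,40,120,20,140]]),
    (1,[[0,10,20,30,121,200,41],[100,110,120,200,40,30,140]]),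
    (1,[[0,10,20,30,130,200,41],[100,110,120,40,200,131,140]]),
    (1,[[0,10,20,30,40,200,141],[41,200,140,30,120,110,100]]),
    (1,[[0,10,20,30,130,200,100],[40,120,110,101,200,131,140]]),
    (1,[[0,10,111,200,130,30,140],[40,120,20,131,200,110,100]]),
    (1,[[0,10,20,131,200,121,40],[100,110,120,200,130,30,140]]),
    (1,[[0,10,20,140,200,130,40],[100,110,120,30,131,200,141]])]"
    by code_simp
qed

text \<open>Again the class consists of the two runs between the common vertices, here 1 and 2, that
  are exchanged.\<close>

lemma separation_0213: "\<exists>tab. separation [0, 1, 2, 3] [0, 2, 1, 3] [(0, 2), (1, 2)] tab"
proof
  show "separation [0, 1, 2, 3] [0, 2, 1, 3] [(0, 2), (1, 2)]
   [(1,[[0,200,20,10,110,30,40],[100,1,200,21,120,130,140]]),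
    (1,[[0,200,101,10,20,30,40],[100,200,1,110,20,130,140]]),
    (1,[[0,200,110,10,20,30,40],[100,1,200,111,20,130,140]]),
    (1,[[0,200,120,110,10,130,40],[100,1,200,121,20,30,140]]),
    (2,[[0,1,10,130,131,40],[0,200,130,10,110,30,40],[100,1,200,130,20,30,140]]),
    (1,[[0,200,140,30,20,10,100],[40,130,20,110,1,200,141]]),
    (1,[[0,10,200,20,120,30,40],[100,110,21,200,11,130,140]]),
    (1,[[0,101,200,11,20,30,40],[100,200,10,110,20,130,140]]),
    (1,[[0,10,200,111,20,130,40],[100,110,200,11,20,30,140]]),
    (1,[[0,10,200,121,20,30,40],[100,110,120,200,11,130,140]]),
    (1,[[0,10,200,130,20,30,40],[100,110,20,11,200,131,140]]),
    (1,[[0,10,11,130,140,141],[40,140,200,11,20,110,100],[100,110,30,130,11,200,141]]),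
    (1,[[0,10,120,21,200,31,40],[100,110,30,200,20,130,140]]),
    (1,[[0,10,120,21,200,40,140],[41,200,20,130,30,110,100]]),
    (1,[[0,101,200,20,120,30,40],[100,200,21,110,10,130,140]]),
    (1,[[0,10,20,200,111,30,40],[100,110,200,21,120,130,140]]),
    (1,[[0,10,20,21,120],[0,10,121,200,21,30,40]]),
    (1,[[0,10,130,200,21,30,40],[100,110,120,20,200,131,140]]),
    (1,[[0,10,120,21,200,140,40],[100,110,30,130,20,200,141]]),
    (1,[[0,101,200,30,20,130,40],[100,101,110,30,31,140],[100,200,30,110,10,130,140]]),
    (1,[[0,10,20,111,200,31,40],[100,110,200,30,20,130,140]]),
    (1,[[0,10,20,120,200,31,40],[100,110,30,200,121,130,140]]),
    (1,[[0,10,20,30,200,131,40],[100,110,20,130,200,31,140]]),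
    (1,[[0,10,20,30,200,140,40],[100,110,20,130,31,200,141]]),
    (1,[[0,10,20,30,40,200,100],[41,200,101,110,20,130,140]]),
    (2,[[0,10,20,111,200,40,140],[0,10,130,30,111,200,41],[41,40,30,111,110,100]]),
    (1,[[0,10,20,120,200,40,140],[41,200,121,130,30,110,100]]),
    (1,[[0,10,20,30,131,200,41],[100,110,20,130,200,40,140]]),
    (1,[[0,10,20,30,40,200,141],[41,200,140,130,20,110,100]]),
    (1,[[0,101,200,120,20,130,40],[100,200,121,10,110,30,140]]),
    (1,[[0,10,121,200,111,30,40],[100,110,200,120,20,130,140]]),
    (1,[[0,10,130,200,120,30,40],[100,110,20,121,200,131,140]]),
    (1,[[0,10,20,120,200,140,40],[100,110,30,130,121,200,141]])]"
    by code_simp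
qed

lemma separation_0231: "\<exists>tab. separation [0, 1, 2, 3] [0, 2, 3, 1] [] tab"
proof
  show "separation [0, 1, 2, 3] [0, 2, 3, 1] []
   [(1,[[0,200,101,10,20,30,40],[100,200,1,110,120,130,140]]),
    (1,[[0,200,110,10,20,30,40],[100,1,200,111,120,130,140]]),
    (1,[[0,200,120,30,130,10,100],[40,121,200,1,110,20,140]]),
    (1,[[0,200,130,30,20,10,100],[40,120,110,1,200,131,140]]),
    (1,[[0,200,140,130,30,110,100],[40,120,20,10,1,200,141]]),
    (1,[[0,101,200,11,20,30,40],[100,200,10,110,120,130,140]]),
    (1,[[0,10,200,111,30,130,140],[40,120,20,11,200,110,100]]),
    (1,[[0,10,200,120,20,130,40],[100,110,30,121,200,11,140]]),
    (1,[[0,10,200,131,20,30,40],[100,110,120,130,200,11,140]]),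
    (1,[[0,10,200,140,20,30,40],[100,110,120,130,11,200,141]]),
    (1,[[0,10,130,30,21,200,100],[40,120,110,101,200,20,140]]),
    (1,[[0,10,20,200,111,30,40],[100,110,200,21,120,130,140]]),
    (1,[[0,10,20,200,120,30,40],[100,110,21,200,121,130,140]]),
    (1,[[0,10,131,200,21,30,40],[100,110,120,130,200,20,140]]),
    (1,[[0,10,140,200,21,30,40],[100,110,120,130,20,200,141]]),
    (1,[[0,10,130,120,30,200,100],[40,31,200,101,110,20,140]]),
    (1,[[0,10,20,111,200,31,40],[100,110,200,30,120,130,140]]),
    (1,[[0,10,20,30,200,121,40],[100,110,120,200,31,130,140]]),
    (1,[[0,10,20,30,200,130,40],[100,110,120,31,200,131,140]]),
    (1,[[0,10,20,120,31,200,141],[40,130,140,200,30,110,100]]),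
    (1,[[0,10,20,30,40,200,100],[41,200,101,110,120,130,140]]),
    (1,[[0,10,130,30,111,200,41],[100,110,200,40,120,20,140]]),
    (1,[[0,10,20,30,121,200,41],[100,110,120,200,40,130,140]]),
    (1,[[0,10,20,30,130,200,41],[100,110,120,40,200,131,140]]),
    (1,[[0,10,20,30,40,200,141],[41,200,140,130,120,110,100]])]"
    by code_simp
qed

text \<open>Here an end run of \<open>P\<close> alone has no links; the remaining cases may then
  take this run to be empty.\<close>

lemma separation_0321: "\<exists>tab. separation [0, 1, 2, 3] [0, 3, 2, 1] [(0, 0)] tab"
proof
  show "separation [0, 1, 2, 3] [0, 3, 2, 1] [(0, 0)]
   [(1,[[0,200,10,110,30,20,140],[40,120,130,11,200,1,100]]),
    (1,[[0,200,20,130,30,110,100],[40,120,21,200,1,10,140]]),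
    (1,[[0,200,30,20,10,110,40],[100,1,200,31,120,130,140]]),
    (1,[[0,200,40,30,20,10,100],[41,200,1,110,120,130,140]]),
    (1,[[0,200,101,10,20,30,40],[100,200,1,110,120,130,140]]),
    (1,[[0,200,110,10,20,30,40],[100,1,200,111,120,130,140]]),
    (1,[[0,200,120,30,20,10,100],[40,110,1,200,121,130,140]]),
    (1,[[0,200,130,30,110,10,140],[40,120,20,131,200,1,100]]),
    (1,[[0,200,140,20,30,110,100],[40,120,130,10,1,200,141]]),
    (1,[[0,101,200,11,20,30,40],[100,200,10,110,120,130,140]]),
    (1,[[0,10,200,111,30,20,140],[40,120,130,11,200,110,100]]),
    (1,[[40,30,20,11,10,100],[140,130,121,120,110,10]]),
    (1,[[0,10,200,131,20,30,40],[100,110,120,130,200,11,140]]),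
    (1,[[0,10,200,140,20,30,40],[100,110,120,130,11,200,141]]),
    (1,[[0,101,200,20,130,30,40],[100,200,21,120,110,10,140]]),
    (1,[[40,30,21,20,10,110],[100,110,111,120,130,140]]),
    (1,[[0,10,20,200,121,30,40],[100,110,120,200,21,130,140]]),
    (1,[[0,10,20,200,130,30,40],[100,110,120,21,200,131,140]]),
    (1,[[0,10,140,200,21,30,40],[100,110,120,130,20,200,141]]),
    (1,[[0,10,20,120,31,200,100],[40,110,101,200,30,130,140]]),
    (1,[[0,10,20,30,200,111,40],[100,110,200,31,120,130,140]]),
    (1,[[0,10,20,30,200,120,40],[100,110,31,200,121,130,140]]),
    (1,[[0,10,20,130,200,31,40],[100,110,120,30,200,131,140]]),
    (2,[[40,31,30,20,10,100],[40,110,10,20,30,200,141],[141,140,130,120,31]]),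
    (1,[[0,10,20,30,40,200,100],[41,200,101,110,120,130,140]]),
    (1,[[0,10,20,30,111,200,41],[100,110,200,40,120,130,140]]),
    (1,[[0,10,20,30,120,200,41],[100,110,40,200,121,130,140]]),
    (2,[[41,40,30,20,10,100],[41,40,30,20,131],[41,200,130,120,110,10,140]]),
    (1,[[0,10,20,30,40,200,141],[41,200,140,130,120,110,100]])]"
    by code_simp
qed

lemma separation_1032: "\<exists>tab. separation [0, 1, 2, 3] [1, 0, 3, 2] [] tab"
proof
  show "separation [0, 1, 2, 3] [1, 0, 3, 2] []
   [(1,[[0,200,101,10,120,30,140],[40,130,20,110,1,200,100]]),
    (1,[[0,200,111,10,20,30,40],[100,110,200,1,120,130,140]]),
    (1,[[0,200,120,10,20,30,40],[100,110,1,200,121,130,140]]),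
    (1,[[0,200,130,120,10,20,140],[40,30,131,200,1,110,100]]),
    (1,[[0,200,140,30,120,10,100],[40,130,20,110,1,200,141]]),
    (1,[[0,10,200,101,20,30,40],[100,200,11,110,120,130,140]]),
    (1,[[0,10,200,110,20,30,40],[100,11,200,111,120,130,140]]),
    (1,[[0,120,200,11,20,30,40],[100,110,10,200,121,130,140]]),
    (1,[[0,10,200,130,30,20,100],[40,120,110,11,200,131,140]]),
    (1,[[0,110,11,200,140,30,40],[100,20,130,120,10,200,141]]),
    (1,[[0,10,101,200,21,30,40],[100,200,20,110,120,130,140]]),
    (1,[[0,10,110,200,21,30,40],[100,20,200,111,120,130,140]]),
    (1,[[0,10,20,200,121,30,140],[40,130,21,200,120,110,100]]),
    (1,[[0,10,20,200,131,30,40],[100,110,120,130,200,21,140]]),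
    (1,[[0,10,20,200,140,30,40],[100,110,120,130,21,200,141]]),
    (1,[[0,10,20,130,31,200,100],[40,120,110,101,200,30,140]]),
    (1,[[0,10,110,200,31,130,140],[40,120,111,200,30,20,100]]),
    (1,[[0,10,20,30,200,121,40],[100,110,120,200,31,130,140]]),
    (1,[[0,10,20,30,200,130,40],[100,110,120,31,200,131,140]]),
    (1,[[0,10,20,140,200,31,40],[100,110,120,130,30,200,141]]),
    (1,[[0,10,20,30,40,200,100],[41,200,101,110,120,130,140]]),
    (1,[[0,10,110,200,40,30,140],[41,200,111,120,130,20,100]]),
    (1,[[0,10,20,30,121,200,41],[100,110,120,200,40,130,140]]),
    (1,[[0,10,20,30,130,200,41],[100,110,120,40,200,131,140]]),
    (1,[[0,10,20,30,40,200,141],[41,200,140,130,120,110,100]])]"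
    by code_simp
qed

lemma separation_1302: "\<exists>tab. separation [0, 1, 2, 3] [1, 3, 0, 2] [] tab"
proof
  show "separation [0, 1, 2, 3] [1, 3, 0, 2] []
   [(1,[[0,200,101,10,120,30,140],[40,110,20,130,1,200,100]]),
    (1,[[0,200,110,10,120,30,140],[40,111,200,1,130,20,100]]),
    (1,[[0,200,121,10,20,30,40],[100,110,120,200,1,130,140]]),
    (1,[[0,200,130,10,20,30,40],[100,110,120,1,200,131,140]]),
    (1,[[0,200,140,20,10,120,40],[100,110,30,130,1,200,141]]),
    (1,[[0,10,200,101,20,30,40],[100,200,11,110,120,130,140]]),
    (1,[[0,10,200,110,20,30,40],[100,11,200,111,120,130,140]]),
    (1,[[0,10,200,120,30,20,100],[40,110,11,200,121,130,140]]),
    (1,[[0,10,200,131,20,110,40],[100,11,200,130,120,30,140]]),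
    (1,[[0,10,200,140,30,110,100],[40,120,130,20,11,200,141]]),
    (1,[[0,10,101,200,21,30,40],[100,200,20,110,120,130,140]]),
    (1,[[0,10,20,200,111,30,140],[40,120,130,21,200,110,100]]),
    (1,[[0,10,110,120,200,21,140],[40,30,130,121,200,20,100]]),
    (1,[[0,10,20,200,131,30,40],[100,110,120,130,200,21,140]]),
    (1,[[0,10,20,200,140,30,40],[100,110,120,130,21,200,141]]),
    (1,[[0,120,31,200,101,20,140],[40,110,10,130,30,200,100]]),
    (1,[[0,10,20,30,200,111,40],[100,110,200,31,120,130,140]]),
    (1,[[0,10,20,30,200,120,40],[100,110,31,200,121,130,140]]),
    (1,[[0,10,20,131,200,31,40],[100,110,120,130,200,30,140]]),
    (1,[[0,10,20,140,200,31,40],[100,110,120,130,30,200,141]]),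
    (1,[[0,10,20,30,40,200,100],[41,200,101,110,120,130,140]]),
    (1,[[0,10,20,30,111,200,41],[100,110,200,40,120,130,140]]),
    (1,[[0,10,20,30,120,200,41],[100,110,40,200,121,130,140]]),
    (1,[[0,10,110,40,200,131,140],[41,200,130,120,30,20,100]]),
    (1,[[0,10,20,30,40,200,141],[41,200,140,130,120,110,100]])]"
    by code_simp
qed

section \<open>Patterns excluded by a single link\<close>

lemma in_segments: "(k, s) \<in> set (segments t) \<longleftrightarrow> k \<le> 1 \<and> s \<le> t"
  by (auto simp: segments_def less_Suc_eq_le le_Suc_eq simp del: upt_Suc)

text \<open>Take the first vertex of \<open>U\<close> or \<open>W\<close> after the head. If it lies
  in \<open>W\<close>, it ends the required stretch; otherwise the search restarts from it on a
  shorter list.\<close>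

lemma crossing_infix:
  assumes "w \<noteq> []" "hd w \<in> U" "last w \<in> W" "U \<inter> W = {}"
  shows "\<exists>a u R v b. w = a @ u # R @ v # b \<and> u \<in> U \<and> v \<in> W \<and> set R \<inter> (U \<union> W) = {}"
  using assms(1-3)
proof (induction w rule: length_induct)
  case (1 w)
  then obtain x w' where w: "w = x # w'" "x \<in> U" by (cases w) auto
  have "w' \<noteq> []" using 1(4) w assms(4) by (cases w') auto
  then have "last w' \<in> U \<union> W" using 1(4) w by simp
  then obtain R y b where w': "w' = R @ y # b" "y \<in> U \<union> W" "\<forall>z\<in>set R. z \<notin> U \<union> W"
    using split_list_first_prop[of w' "\<lambda>y. y \<in> U \<union> W"] last_in_set[OF \<open>w' \<noteq> []\<close>] by blast
  show ?case
  proof (cases "y \<in> W")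
    case True
    have "w = [] @ x # R @ y # b" "set R \<inter> (U \<union> W) = {}" using w(1) w'(1,3) by auto
    then show ?thesis using w(2) True by metis
  next
    case False
    have "length (y # b) < length w" "last (y # b) \<in> W" "hd (y # b) \<in> U"
      using 1(4) w(1) w'(1,2) False by simp_all
    then obtain a u S v d where *: "y # b = a @ u # S @ v # d" "u \<in> U" "v \<in> W" "set S \<inter> (U \<union> W) = {}"
      using 1(1) by (metis list.distinct(1))
    then have "w = (x # R @ a) @ u # S @ v # d" using w(1) w'(1) by simp
    then show ?thesis using *(2-4) by metis
  qed
qed

lemma list_all2_ex: "list_all2 R xs ys \<Longrightarrow> x \<in> set xs \<Longrightarrow> \<exists>y. R x y"
  by (induction rule: list_all2_induct) auto

lemma (in longest_pair) ex_link:
  assumes "U \<subseteq> set P \<union> set Q - X" "u \<in> U" "v \<in> set P \<union> set Q - X" "v \<notin> U"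
  obtains p R q where "p \<in> U" "q \<in> set P \<union> set Q - X - U" "link p R q"
proof -
  let ?W = "set P \<union> set Q - X - U"
  obtain w where w: "w \<noteq> []" "distinct w" "successively E w" "hd w = u" "last w = v" "set w \<inter> X = {}"
    using joined[of u v] assms by blast
  obtain a p R q b where s: "w = a @ p # R @ q # b" "p \<in> U" "q \<in> ?W" "set R \<inter> (U \<union> ?W) = {}"
    using crossing_infix[of w U ?W] w assms by blast
  have "successively E (p # R @ [q])"
  proof -
    have "w = a @ (p # R @ [q]) @ b" using s(1) by simp
    then show ?thesis using w(3) by (simp only: successively_append_iff)
  qed
  moreover have "set R \<inter> (set P \<union> set Q) = {}" using s w(6) by auto
  ultimately have "link p R q" using w(2) s(1) by (auto simp: link_def)
  then show ?thesis using that s by blast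
qed

text \<open>Walk the first link backwards from \<open>q\<close> until it meets the second for the
  first time, then follow the second to \<open>w\<close>. Stopping at the first meeting keeps the
  vertices distinct.\<close>

lemma (in longest_pair) link_combine:
  assumes "link p R q" "link u S w" "set R \<inter> set S \<noteq> {}"
  obtains T where "link q T w"
proof -
  have "\<exists>x\<in>set (rev R). x \<in> set S" using assms(3) by auto
  then obtain a x b where r: "rev R = a @ x # b" "x \<in> set S" "\<forall>y\<in>set a. y \<notin> set S"
    using split_list_first_prop[of "rev R" "\<lambda>y. y \<in> set S"] by blast
  obtain c d where s: "S = c @ x # d" using split_list[OF r(2)] by blast
  have R: "link q (a @ x # b) p" using link_sym[OF assms(1)] r(1) by simp
  have "successively E ((q # a) @ x # (b @ [p]))" using R by (simp add: link_def)
  then have "successively E ((q # a) @ [x])" by (rule successively_glue[THEN iffD1, THEN conjunct1])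
  moreover have "successively E ((u # c) @ x # (d @ [w]))" using assms(2) s by (simp add: link_def)
  then have "successively E (x # d @ [w])" by (rule successively_glue[THEN iffD1, THEN conjunct2])
  ultimately have "successively E ((q # a) @ x # (d @ [w]))" by (subst successively_glue) (rule conjI)
  moreover have "distinct (a @ x # d)" "set (a @ x # d) \<inter> (set P \<union> set Q) = {}"
    using R assms(2) r(3) s by (auto simp: link_def)
  ultimately have "link q (a @ x # d) w" by (simp add: link_def)
  then show ?thesis by (rule that)
qed

section \<open>Two longest paths with numbered common vertices\<close>

locale labelled_pair = longest_pair E P Q N
  for E :: "'a \<Rightarrow> 'a \<Rightarrow> bool" and P Q :: "'a list" and N :: nat +
  fixes \<nu> :: "nat \<Rightarrow> 'a" and xs ys :: "nat list"
  assumes labels: "filter (\<lambda>v. v \<in> X) P = map \<nu> xs" "filter (\<lambda>v. v \<in> X) Q = map \<nu> ys"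
    and same_labels: "set ys = set xs" "length ys = length xs"
    and few_labels: "set xs \<subseteq> {..<5}" "length xs \<le> 9"
begin

lemma filter_lengths: "length (filter (\<lambda>v. v \<in> X) P) = length xs" "length (filter (\<lambda>v. v \<in> X) Q) = length xs"
  using labels same_labels by simp_all

lemma in_run_0: "v \<in> set P - X \<longleftrightarrow> (\<exists>s \<le> length xs. v \<in> set (run 0 s))"
  using in_runs[of v P X] unfolding filter_lengths run_def by simp

lemma in_run_1: "v \<in> set Q - X \<longleftrightarrow> (\<exists>s \<le> length xs. v \<in> set (run 1 s))"
  using in_runs[of v Q X] unfolding filter_lengths run_def by simp

lemma in_run: "v \<in> set P \<union> set Q - X \<longleftrightarrow> (\<exists>k\<le>1. \<exists>s \<le> length xs. v \<in> set (run k s))"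
proof -
  have "v \<in> set P \<union> set Q - X \<longleftrightarrow> v \<in> set P - X \<or> v \<in> set Q - X" by auto
  also have "\<dots> \<longleftrightarrow> (\<exists>k\<le>1. \<exists>s \<le> length xs. v \<in> set (run k s))"
    unfolding in_run_0 in_run_1 by (metis One_nat_def le_0_eq le_Suc_eq order_refl)
  finally show ?thesis .
qed

lemma run_distinct: "s \<le> length xs \<Longrightarrow> distinct (run k s)"
  unfolding run_def
  using distinct_runs[OF distinct_paths(1), of s X, unfolded filter_lengths]
    distinct_runs[OF distinct_paths(2), of s X, unfolded filter_lengths]
  by (cases "k = 0") simp_all

lemma run_unique:
  assumes "v \<in> set (run k s)" "v \<in> set (run k' s')" "k \<le> 1" "k' \<le> 1" "s \<le> length xs" "s' \<le> length xs"
  shows "k = k' \<and> s = s'"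
proof (cases "k = k'")
  case True
  then show ?thesis
    using assms runs_unique[OF distinct_paths(1), of s X s' v, unfolded filter_lengths]
      runs_unique[OF distinct_paths(2), of s X s' v, unfolded filter_lengths]
    unfolding run_def by (cases "k = 0") simp_all
next
  case False
  then have "v \<in> set P - X" "v \<in> set Q - X"
    using assms in_run_0 in_run_1 by (metis One_nat_def le_0_eq le_Suc_eq)+
  then show ?thesis by auto
qed

text \<open>A distinct list with at most one element is determined by its set, so the position on
  the run does not matter.\<close>

lemma filter_run:
  assumes "s \<le> length xs" "set (run k s) \<inter> A = set l" "distinct l" "length l \<le> 1"
  shows "filter (\<lambda>v. v \<in> A) (run k s) = l"
proof -
  have d: "distinct (filter (\<lambda>v. v \<in> A) (run k s))" using run_distinct[OF assms(1)] by simp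
  have e: "set (filter (\<lambda>v. v \<in> A) (run k s)) = set l" using assms(2) by auto
  then have "length (filter (\<lambda>v. v \<in> A) (run k s)) = length l"
    using d assms(3) by (metis distinct_card)
  then show ?thesis using e assms(4) by (cases l; cases "filter (\<lambda>v. v \<in> A) (run k s)") auto
qed

text \<open>Labels of common vertices are below 5, so the ends of the link can be numbered 5 and 6
  without affecting them. Both runs may lie on the same path.\<close>

lemma single_link_not_refuted:
  assumes "c = (k, i)" "d = (k', j)" "k \<le> 1" "k' \<le> 1" "i \<le> length xs" "j \<le> length xs" "c \<noteq> d"
    and "p \<in> set (run k i)" "q \<in> set (run k' j)" "link p R q"
    and emp: "\<And>k s. (k, s) \<in> set emp \<Longrightarrow> k \<le> 1 \<and> s \<le> 9 \<and> run k s = []"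
  shows "\<not> refuted xs ys [(c, [5]), (d, [6])] [(5, 6)] emp cert"
proof -
  let ?\<nu> = "\<nu>(5 := p, 6 := q)" and ?att = "[(c, [5]), (d, [6])] :: attachment"
  have lab: "map ?\<nu> xs = map \<nu> xs" "map ?\<nu> ys = map \<nu> ys"
    using few_labels(1) same_labels(1) by auto
  have pq: "p \<noteq> q" using run_unique assms by blast
  have att: "filter (\<lambda>v. v \<in> {p, q}) (run l s) = map ?\<nu> (attached ?att l s) \<and> length (attached ?att l s) \<le> 9"
    if "s \<le> length xs" "l \<le> 1" for l s
  proof -
    have p: "p \<in> set (run l s) \<longleftrightarrow> (l, s) = c" and q: "q \<in> set (run l s) \<longleftrightarrow> (l, s) = d"
      using run_unique[OF assms(8), of l s] run_unique[OF assms(9), of l s] that assms by auto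
    have 1: "set (run l s) \<inter> {p, q} = set (map ?\<nu> (attached ?att l s))"
      using p q assms(7) by (auto simp: attached_def)
    have 2: "length (map ?\<nu> (attached ?att l s)) \<le> 1" by (simp add: attached_def)
    have 3: "distinct (map ?\<nu> (attached ?att l s))" by (simp add: attached_def)
    show ?thesis
    proof
      show "length (attached ?att l s) \<le> 9" using 2 by simp
    qed (rule filter_run[OF that(1) 1 3 2])
  qed
  have U: "{5, 6} = (\<Union>s\<le>length xs. set (attached ?att 0 s)) \<union> (\<Union>s\<le>length ys. set (attached ?att 1 s))"
    (is "_ = ?U")
  proof
    have "attached ?att k i = [5]" "attached ?att k' j = [6]"
      using assms(1,2,7) by (auto simp: attached_def)
    moreover have "set (attached ?att l s) \<subseteq> ?U" if "l \<le> 1" "s \<le> length xs" for l s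
    proof -
      have "l = 0 \<or> l = 1" using that(1) by auto
      then show ?thesis using that(2) same_labels(2) by (elim disjE) auto
    qed
    ultimately show "{5, 6} \<subseteq> ?U" using assms(3-6) by fastforce
    have "set (attached ?att l s) \<subseteq> {5, 6}" for l s by (auto simp: attached_def)
    then show "?U \<subseteq> {5, 6}" by blast
  qed
  show ?thesis
  proof (rule links_not_refuted[where \<nu> = ?\<nu> and A = "{p, q}" and U = "{5, 6}" and Rs = "[R]"])
    show "filter (\<lambda>v. v \<in> X) P = map ?\<nu> xs" "filter (\<lambda>v. v \<in> X) Q = map ?\<nu> ys"
      by (simp_all only: lab labels)
    show "set ys = set xs" "length xs \<le> 9" "length ys \<le> 9"
      using same_labels few_labels by simp_all
    show "filter (\<lambda>v. v \<in> {p, q}) (run 0 s) = map ?\<nu> (attached ?att 0 s) \<and> length (attached ?att 0 s) \<le> 9"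
      if "s \<le> length xs" for s using att[OF that, of 0] by blast
    show "filter (\<lambda>v. v \<in> {p, q}) (run 1 s) = map ?\<nu> (attached ?att 1 s) \<and> length (attached ?att 1 s) \<le> 9"
      if "s \<le> length ys" for s using att[of s 1] that same_labels(2) by simp
    show "inj_on ?\<nu> {5, 6}" using pq by auto
    show "u \<in> {5, 6} \<and> v \<in> {5, 6} \<and> u \<noteq> v \<and> link (?\<nu> u) ([R] ! i) (?\<nu> v)"
      if "i < length [(5, 6)]" "[(5, 6)] ! i = (u, v)" for i u v
      using that assms(10) by auto
    show "k \<le> 1 \<and> s \<le> 9 \<and> run k s = []" if "(k, s) \<in> set emp" for k s
      using emp[OF that] .
  qed (simp_all add: U)
qed

lemma separation_impossible: "\<not> separation xs ys lab tab"
proof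
  assume sep: "separation xs ys lab tab"
  let ?S = "segments (length xs)"
  let ?emp = "\<lambda>c d. if (c \<in> set lab) = (d \<in> set lab) then filter (\<lambda>e. (e \<in> set lab) \<noteq> (c \<in> set lab)) ?S else []"
  note S = in_segments[of _ _ "length xs"]
  have tab: "\<exists>cert. refuted xs ys [(c, [5]), (d, [6])] [(5, 6)] (?emp c d) cert"
    if "c \<in> set ?S" "d \<in> set ?S" "before c d" "fst c \<noteq> fst d \<or> (c \<in> set lab) \<noteq> (d \<in> set lab)" for c d
  proof -
    let ?l = "filter (\<lambda>(c, d). before c d \<and> (fst c \<noteq> fst d \<or> (c \<in> set lab) \<noteq> (d \<in> set lab)))
         (List.product ?S ?S)"
    have "(c, d) \<in> set ?l" using that by simp
    from list_all2_ex[OF sep[unfolded separation_def Let_def] this] show ?thesis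
      by (simp only: prod.case)
  qed
  have before: "before c d \<or> before d c" if "c \<noteq> d" for c d
    using that by (auto simp: before_def prod_eq_iff)
  \<comment> \<open>Between the two classes every link is refuted without any assumption on empty
    runs, even if both ends lie on one path.\<close>
  have mixed1: False
    if "k \<le> 1" "k' \<le> 1" "i \<le> length xs" "j \<le> length xs" "p \<in> set (run k i)" "q \<in> set (run k' j)"
      "link p R q" "((k, i) \<in> set lab) \<noteq> ((k', j) \<in> set lab)" "before (k, i) (k', j)" for k k' i j p q R
  proof -
    have "(k, i) \<in> set ?S" "(k', j) \<in> set ?S" using that(1-4) S by simp_all
    from tab[OF this that(9)] that(8)
    obtain cert where "refuted xs ys [((k, i), [5]), ((k', j), [6])] [(5, 6)] (?emp (k, i) (k', j)) cert"
      by blast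
    then have "refuted xs ys [((k, i), [5]), ((k', j), [6])] [(5, 6)] [] cert"
      using that(8) by (simp only: if_False)
    moreover have "(k, i) \<noteq> (k', j)" using that(8) by auto
    ultimately show False using single_link_not_refuted[OF refl refl that(1-4) _ that(5-7), of "[]" cert] by simp
  qed
  have mixed: False
    if "k \<le> 1" "k' \<le> 1" "i \<le> length xs" "j \<le> length xs" "p \<in> set (run k i)" "q \<in> set (run k' j)"
      "link p R q" "((k, i) \<in> set lab) \<noteq> ((k', j) \<in> set lab)" for k k' i j p q R
  proof -
    have "(k, i) \<noteq> (k', j)" using that(8) by auto
    then show False
      using mixed1[OF that] mixed1[OF that(2,1,4,3,6,5) link_sym[OF that(7)]] that(8) before by blast
  qed
  \<comment> \<open>Connectedness is applied to the vertices of \<open>P\<close> outside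
    \<open>X\<close>, which gives a link from \<open>P\<close> to \<open>Q\<close>.\<close>
  obtain p0 q0 where "p0 \<in> set P - X" "q0 \<in> set P \<union> set Q - X" "q0 \<notin> set P - X" using proper by auto
  then obtain p R q where pq: "p \<in> set P - X" "q \<in> set P \<union> set Q - X - (set P - X)" "link p R q"
    by (rule ex_link[rotated]) auto
  obtain i where i: "i \<le> length xs" "p \<in> set (run 0 i)" using pq(1) in_run_0 by auto
  obtain j where j: "j \<le> length xs" "q \<in> set (run 1 j)" using pq(2) in_run_1[of q] by auto
  have eq: "((0, i) \<in> set lab) = ((1, j) \<in> set lab)"
    using mixed[of 0 1 i j p q R] i j pq by auto
  \<comment> \<open>If the other class contained a vertex, connectedness would produce a link
    leaving the class of \<open>(0, i)\<close>, contrary to \<open>mixed\<close>.\<close>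
  have empty: "run k s = []" if ks: "k \<le> 1" "s \<le> length xs" "((k, s) \<in> set lab) \<noteq> ((0, i) \<in> set lab)" for k s
  proof (rule ccontr)
    assume "run k s \<noteq> []"
    then obtain v where v: "v \<in> set (run k s)" by (cases "run k s") auto
    define U where "U = {x. \<exists>k\<le>1. \<exists>s\<le>length xs. x \<in> set (run k s) \<and> ((k, s) \<in> set lab) = ((0, i) \<in> set lab)}"
    have "U \<subseteq> set P \<union> set Q - X" using in_run by (auto simp: U_def)
    moreover have "p \<in> U" using i by (auto simp: U_def)
    moreover have "v \<in> set P \<union> set Q - X" using in_run v ks by blast
    moreover have "v \<notin> U" using run_unique[OF v _ ks(1) _ ks(2)] ks(3) unfolding U_def by blast
    ultimately obtain x T y where xy: "x \<in> U" "y \<in> set P \<union> set Q - X - U" "link x T y"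
      by (rule ex_link)
    obtain l r where l: "l \<le> 1" "r \<le> length xs" "x \<in> set (run l r)" "((l, r) \<in> set lab) = ((0, i) \<in> set lab)"
      using xy(1) by (auto simp: U_def)
    obtain l' r' where l': "l' \<le> 1" "r' \<le> length xs" "y \<in> set (run l' r')"
      using xy(2) in_run[of y] by auto
    have "((l', r') \<in> set lab) \<noteq> ((0, i) \<in> set lab)" using xy(2) l' unfolding U_def by blast
    then have "((l, r) \<in> set lab) \<noteq> ((l', r') \<in> set lab)" using l(4) by simp
    then show False by (rule mixed[OF l(1) l'(1) l(2) l'(2) l(3) l'(3) xy(3)])
  qed
  have "(0, i) \<in> set ?S" "(1, j) \<in> set ?S" "before (0, i) (1, j)" "fst (0::nat, i) \<noteq> fst (1::nat, j)"
    using i j S by (simp_all add: before_def)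
  then obtain cert where "refuted xs ys [((0, i), [5]), ((1, j), [6])] [(5, 6)] (?emp (0, i) (1, j)) cert"
    using tab by blast
  moreover have "\<not> refuted xs ys [((0, i), [5]), ((1, j), [6])] [(5, 6)] (?emp (0, i) (1, j)) cert"
  proof (rule single_link_not_refuted[OF refl refl _ _ i(1) j(1) _ i(2) j(2) pq(3)])
    fix k s assume ks: "(k, s) \<in> set (?emp (0, i) (1, j))"
    have "(k, s) \<in> set ?S" "((k, s) \<in> set lab) \<noteq> ((0, i) \<in> set lab)"
      using ks unfolding if_P[OF eq] by simp_all
    then show "k \<le> 1 \<and> s \<le> 9 \<and> run k s = []" using empty S few_labels(2) by (meson order_trans)
  qed simp_all
  ultimately show False by blast
qed

end

section \<open>Four common vertices in the same order\<close>

text \<open>The difference is 2 or 3, written without truncated subtraction. On indices up to 4 this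
  is adjacency in the pentagon.\<close>

definition far :: "nat \<Rightarrow> nat \<Rightarrow> bool" where
  "far i j \<longleftrightarrow> i + 2 \<le> j \<and> j < i + 4 \<or> j + 2 \<le> i \<and> i < j + 4"

lemma far_sym: "far i j \<Longrightarrow> far j i"
  by (auto simp: far_def)

text \<open>This excludes two meeting links from one run to different neighbours: they would combine
  to a link between these neighbours.\<close>

lemma far_no_triangle:
  assumes "far i j" "far i k" "j \<noteq> k" "i \<le> 4" "j \<le> 4" "k \<le> 4"
  shows "\<not> far j k"
  using assms unfolding far_def by arith

abbreviation identity :: "nat list" where "identity \<equiv> [0, 1, 2, 3]"

definition near_certified :: "(nat \<times> nat list list) list \<Rightarrow> bool" where
  "near_certified tab \<longleftrightarrow> list_all2 (\<lambda>(c, d). refuted identity identity [(c, [5]), (d, [6])] [(5, 6)] [])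
     (filter (\<lambda>(c, d). before c d \<and> \<not> far (snd c) (snd d)) (List.product (segments 4) (segments 4))) tab"

text \<open>One link between \<open>far\<close> runs is refuted only under the assumption that all
  runs with other indices are empty; \<open>identity_impossible\<close> establishes this from the
  absence of forks.\<close>

definition far_certified :: "(nat \<times> nat list list) list \<Rightarrow> bool" where
  "far_certified tab \<longleftrightarrow>
     list_all2 (\<lambda>(m, n). refuted identity identity [((0, m), [5]), ((1, n), [6])] [(5, 6)]
         (filter (\<lambda>e. snd e \<noteq> m \<and> snd e \<noteq> n) (segments 4)))
       (filter (\<lambda>(m, n). far m n) (List.product [0..<5] [0..<5])) tab"

text \<open>In the last two cases of \<open>l\<close>, the second link starts before the first one on the run \<open>m\<close>, or at the
  same vertex.\<close>

definition forks_certified :: "(nat \<times> nat list list) list \<Rightarrow> bool" where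
  "forks_certified tab \<longleftrightarrow>
     list_all2 (\<lambda>((m, n, r), k, k', l).
         refuted identity identity [((0, m), l), ((k, n), [6]), ((k', r), [8])] [(5, 6), (if l = [5] then 5 else 7, 8)] [])
       (List.product
         (filter (\<lambda>(m, n, r). far m n \<and> far m r \<and> n < r)
           (List.product [0..<5] (List.product [0..<5] [0..<5])))
         (List.product [0, 1] (List.product [0, 1] [[5, 7], [7, 5], [5]]))) tab"

lemma near_links: "\<exists>tab. near_certified tab"
proof
  show "near_certified
   [(1,[[0,200,10,110,20,30,40],[100,1,200,11,120,130,140]]),
    (1,[[0,200,40,30,20,10,100],[41,200,1,110,120,130,140]]),
    (1,[[0,200,101,10,20,30,40],[100,200,1,110,120,130,140]]),
    (1,[[0,200,110,10,20,30,40],[100,1,200,111,120,130,140]]),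
    (1,[[0,200,140,30,20,10,100],[40,130,120,110,1,200,141]]),
    (1,[[0,10,200,20,120,30,40],[100,110,11,200,21,130,140]]),
    (1,[[0,101,200,11,20,30,40],[100,200,10,110,120,130,140]]),
    (1,[[0,10,200,111,20,30,40],[100,110,200,11,120,130,140]]),
    (1,[[0,10,200,120,20,30,40],[100,110,11,200,121,130,140]]),
    (1,[[0,10,20,200,30,130,40],[100,110,120,21,200,31,140]]),
    (1,[[0,10,111,200,21,30,40],[100,110,200,20,120,130,140]]),
    (1,[[0,10,20,200,121,30,40],[100,110,120,200,21,130,140]]),
    (1,[[0,10,20,200,130,30,40],[100,110,120,21,200,131,140]]),
    (1,[[0,10,20,30,200,40,140],[41,200,31,130,120,110,100]]),
    (1,[[0,10,20,121,200,31,40],[100,110,120,200,30,130,140]]),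
    (1,[[0,10,20,30,200,131,40],[100,110,120,130,200,31,140]]),
    (1,[[0,10,20,30,200,140,40],[100,110,120,130,31,200,141]]),
    (1,[[0,10,20,30,40,200,100],[41,200,101,110,120,130,140]]),
    (1,[[0,10,20,30,131,200,41],[100,110,120,130,200,40,140]]),
    (1,[[0,10,20,30,40,200,141],[41,200,140,130,120,110,100]]),
    (1,[[0,101,200,111,20,30,40],[100,200,110,10,120,130,140]]),
    (1,[[0,10,20,30,140,200,100],[40,130,120,110,101,200,141]]),
    (1,[[0,10,111,200,121,30,40],[100,110,200,120,20,130,140]]),
    (1,[[0,10,20,121,200,131,40],[100,110,120,200,130,30,140]]),
    (1,[[0,10,20,30,131,200,141],[40,140,200,130,120,110,100]])]"
    by code_simp
qed

lemma far_links: "\<exists>tab. far_certified tab"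
proof
  show "far_certified
   [(1,[[0,1,10,20,121],[40,30,20,120,200,1,100]]),
    (1,[[0,1,10,20,30,131],[0,200,130,20,10,100]]),
    (1,[[0,10,11,20,30,40],[40,131,130,20,110,10]]),
    (1,[[0,10,11,20,30,40],[141,140,30,20,110,10]]),
    (1,[[0,10,120,21,200,100],[0,101,200,20,120,30,40]]),
    (1,[[0,10,20,21,30,140,141],[0,10,120,21,200,140,40]]),
    (1,[[0,10,20,30,31,40],[100,101,10,20,130,31]]),
    (1,[[0,10,20,30,31,40],[0,110,111,20,130,31]]),
    (1,[[0,10,111,200,40,30],[41,200,110,10,20,30,140]]),
    (1,[[0,10,20,121,200,40,140],[0,10,120,121,30,40,41]])]"
    by code_simp
qed

lemma forks: "\<exists>tab. forks_certified tab"
proof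
  show "forks_certified
   [(1,[[0,200,20,10,2,201,30,130,40],[100,110,120,21,200,1,201,31,140]]),
    (1,[[0,1,2,10,120,130,40],[100,110,20,200,1,201,30,130,140],[100,110,120,21,200,1,201,31,140]]),
    (1,[[0,1,10,120,130,40],[100,110,20,200,201,30,130,140],[100,110,120,21,200,201,31,140]]),
    (1,[[0,200,20,10,2,201,130,30,40],[100,110,120,21,200,1,201,131,140]]),
    (1,[[0,1,2,10,120,130,131,40],[100,110,20,200,1,201,130,30,140],[100,110,120,21,200,1,201,131,140]]),
    (1,[[0,1,10,120,130,131,40],[100,110,20,200,201,130,30,140],[100,110,120,21,200,201,131,140]]),
    (1,[[0,200,120,10,2,201,30,130,40],[100,110,20,121,200,1,201,31,140]]),
    (1,[[0,1,2,10,120,121,130,40],[100,110,20,121,200,1,201,31,140],[100,110,120,200,1,201,30,130,140]]),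
    (1,[[0,1,10,120,121,130,40],[100,110,20,121,200,201,31,140],[100,110,120,200,201,30,130,140]]),
    (1,[[0,200,120,10,2,201,130,30,40],[100,110,20,121,200,1,201,131,140]]),
    (1,[[0,1,2,10,120,121,130,131,40],[100,110,20,121,200,1,201,131,140],[100,110,120,200,1,201,130,30,140]]),
    (1,[[0,1,10,120,121,130,131,40],[100,110,20,121,200,201,131,140],[100,110,120,200,201,130,30,140]]),
    (1,[[0,10,200,30,20,12,201,40,140],[41,201,11,200,31,130,120,110,100]]),
    (1,[[0,10,11,12,20,130,140],[41,201,11,200,31,130,120,110,100],[100,110,120,30,200,11,201,40,140]]),
    (1,[[0,10,11,20,130,140],[41,201,200,31,130,120,110,100],[100,110,120,30,200,201,40,140]]),
    (1,[[0,10,200,30,20,12,201,140,40],[100,110,120,130,31,200,11,201,141]]),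
    (1,[[0,10,11,12,20,130,140,141],[40,140,201,11,200,30,120,110,100],[100,110,120,130,31,200,11,201,141]]),
    (1,[[0,10,11,20,130,140,141],[40,140,201,200,30,120,110,100],[100,110,120,130,31,200,201,141]]),
    (1,[[0,10,200,130,20,12,201,40,140],[41,201,11,200,131,30,120,110,100]]),
    (1,[[0,10,11,12,20,130,131,140],[41,201,11,200,131,30,120,110,100],[100,110,120,130,200,11,201,40,140]]),
    (1,[[0,10,11,20,130,131,140],[41,201,200,131,30,120,110,100],[100,110,120,130,200,201,40,140]]),
    (1,[[0,10,200,130,20,12,201,140,40],[100,110,120,30,131,200,11,201,141]]),
    (1,[[0,10,11,12,20,130,131,140,141],[40,140,201,11,200,130,120,110,100],[100,110,120,30,131,200,11,201,141]]),
    (1,[[0,10,11,20,130,131,140,141],[40,140,201,200,130,120,110,100],[100,110,120,30,131,200,201,141]]),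
    (1,[[0,200,21,201,40,30,120,10,100],[41,201,21,200,1,110,120,130,140],[100,110,20,21,22,130,140]]),
    (1,[[0,200,21,201,40,30,120,10,100],[41,201,20,110,1,200,22,130,140]]),
    (1,[[0,200,201,40,30,120,10,100],[41,201,200,1,110,120,130,140],[100,110,20,21,130,140]]),
    (1,[[0,200,21,201,140,30,120,10,100],[40,130,120,110,1,200,21,201,141],[100,110,20,21,22,130,140,141]]),
    (1,[[0,200,21,201,140,30,120,10,100],[40,130,22,200,1,110,20,201,141]]),
    (1,[[0,200,201,140,30,120,10,100],[40,130,120,110,1,200,201,141],[100,110,20,21,130,140,141]]),
    (1,[[0,10,120,30,40,201,21,200,100],[41,201,21,200,101,110,120,130,140],[100,101,110,20,21,22,130,140]]),
    (1,[[0,10,20,201,40,30,22,200,100],[41,201,21,200,101,110,120,130,140]]),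
    (1,[[0,10,120,30,40,201,200,100],[41,201,200,101,110,120,130,140],[100,101,110,20,21,130,140]]),
    (1,[[0,10,120,30,140,201,21,200,100],[40,130,120,110,101,200,21,201,141],[100,101,110,20,21,22,130,140,141]]),
    (1,[[0,10,20,201,140,30,22,200,100],[40,130,120,110,101,200,21,201,141]]),
    (1,[[0,10,120,30,140,201,200,100],[40,130,120,110,101,200,201,141],[100,101,110,20,21,130,140,141]]),
    (1,[[0,200,30,20,110,10,201,32,40],[100,1,200,31,201,11,120,130,140]]),
    (1,[[0,200,31,201,10,110,20,130,40],[100,1,200,31,201,11,120,130,140],[100,110,120,30,31,32,140]]),
    (1,[[0,200,201,10,110,20,130,40],[100,1,200,201,11,120,130,140],[100,110,120,30,31,140]]),
    (1,[[0,200,30,20,10,110,201,32,40],[100,1,200,31,201,111,120,130,140]]),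
    (1,[[0,200,31,201,110,10,20,130,40],[100,1,200,31,201,111,120,130,140],[100,110,111,120,30,31,32,140]]),
    (1,[[0,200,201,110,10,20,130,40],[100,1,200,201,111,120,130,140],[100,110,111,120,30,31,140]]),
    (1,[[0,101,200,30,20,11,201,32,40],[100,200,31,201,10,110,120,130,140]]),
    (1,[[0,101,200,31,201,11,20,130,40],[100,101,110,120,30,31,32,140],[100,200,31,201,10,110,120,130,140]]),
    (1,[[0,101,200,201,11,20,130,40],[100,101,110,120,30,31,140],[100,200,201,10,110,120,130,140]]),
    (1,[[0,101,200,30,20,111,201,32,40],[100,200,31,201,110,10,120,130,140]]),
    (1,[[0,101,200,31,201,111,20,130,40],[100,101,110,111,120,30,31,32,140],[100,200,31,201,110,10,120,130,140]]),
    (1,[[0,101,200,201,111,20,130,40],[100,101,110,111,120,30,31,140],[100,200,201,110,10,120,130,140]]),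
    (1,[[0,10,200,40,30,120,20,201,42],[100,110,11,200,41,201,21,130,140]]),
    (1,[[0,10,200,41,201,20,120,30,140],[42,41,40,130,120,110,100],[100,110,11,200,41,201,21,130,140]]),
    (1,[[0,10,200,201,20,120,30,140],[41,40,130,120,110,100],[100,110,11,200,201,21,130,140]]),
    (1,[[0,10,200,40,30,20,120,201,42],[100,110,11,200,41,201,121,130,140]]),
    (1,[[0,10,200,41,201,120,20,30,140],[42,41,40,130,121,120,110,100],[100,110,11,200,41,201,121,130,140]]),
    (1,[[0,10,200,201,120,20,30,140],[41,40,130,121,120,110,100],[100,110,11,200,201,121,130,140]]),
    (1,[[0,10,111,200,40,30,21,201,42],[100,110,200,41,201,20,120,130,140]]),
    (1,[[0,10,111,200,41,201,21,30,140],[42,41,40,130,120,111,110,100],[100,110,200,41,201,20,120,130,140]]),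
    (1,[[0,10,111,200,201,21,30,140],[41,40,130,120,111,110,100],[100,110,200,201,20,120,130,140]]),
    (1,[[0,10,111,200,40,30,121,201,42],[100,110,200,41,201,120,20,130,140]]),
    (1,[[0,10,111,200,41,201,121,30,140],[42,41,40,130,121,120,111,110,100],[100,110,200,41,201,120,20,130,140]]),
    (1,[[0,10,111,200,201,121,30,140],[41,40,130,121,120,111,110,100],[100,110,200,201,120,20,130,140]])]"
    by code_simp
qed

section \<open>Exchanging the two paths\<close>

lemma longest_pair_swap:
  assumes "longest_pair E P Q N" shows "longest_pair E Q P N"
proof -
  interpret longest_pair E P Q N by fact
  show ?thesis
  proof
    fix u v
    assume "u \<in> set Q \<union> set P - set Q \<inter> set P" "v \<in> set Q \<union> set P - set Q \<inter> set P"
    then show "\<exists>w. w \<noteq> [] \<and> distinct w \<and> successively E w \<and> hd w = u \<and> last w = v \<and> set w \<inter> (set Q \<inter> set P) = {}"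
      using joined[of u v] by (simp add: Un_commute Int_commute)
  qed (use sym walks distinct_paths lengths maximal proper in auto)
qed

lemma labelled_pair_swap:
  assumes "labelled_pair E P Q N \<nu> xs ys" shows "labelled_pair E Q P N \<nu> ys xs"
proof -
  interpret labelled_pair E P Q N \<nu> xs ys by fact
  show ?thesis
  proof (rule labelled_pair.intro)
    show "longest_pair E Q P N" by (rule longest_pair_swap) unfold_locales
    show "labelled_pair_axioms Q P \<nu> ys xs"
    proof
      show "filter (\<lambda>v. v \<in> set Q \<inter> set P) Q = map \<nu> ys" "filter (\<lambda>v. v \<in> set Q \<inter> set P) P = map \<nu> xs"
        using labels by (simp_all add: Int_commute)
    qed (use same_labels few_labels in auto)
  qed
qed

context longest_pair
begin

lemma swapped_link: "longest_pair.link E Q P p R q \<longleftrightarrow> link p R q"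
proof -
  interpret sw: longest_pair E Q P N by (rule longest_pair_swap) unfold_locales
  show ?thesis by (auto simp: sw.link_def link_def)
qed

lemma swapped_run: "k \<le> 1 \<Longrightarrow> longest_pair.run Q P (1 - k) s = run k s"
proof -
  interpret sw: longest_pair E Q P N by (rule longest_pair_swap) unfold_locales
  assume "k \<le> 1"
  then show ?thesis by (cases "k = 0") (simp_all add: sw.run_def run_def Int_commute)
qed

end

context labelled_pair
begin

text \<open>Nothing is known about the relative position of the two ends on run \<open>m\<close>. So
  the order \<open>l\<close> is obtained rather than given, and all three cases need
  certificates.\<close>

lemma two_links_not_refuted:
  assumes m: "m \<le> length xs" "n \<le> length xs" "r \<le> length xs" "m \<noteq> n" "m \<noteq> r" "n \<noteq> r"
    and k: "k \<le> 1" "k' \<le> 1"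
    and p: "p \<in> set (run 0 m)" "u \<in> set (run 0 m)" "q \<in> set (run k n)" "w \<in> set (run k' r)"
    and links: "link p R q" "link u S w" "set R \<inter> set S = {}"
  obtains l where "l \<in> {[5, 7], [7, 5], [5]}"
    and "\<And>cert. \<not> refuted xs ys [((0, m), l), ((k, n), [6]), ((k', r), [8])]
           [(5, 6), (if l = [5] then 5 else 7, 8)] [] cert"
proof -
  define A where "A = {p, u, q, w}"
  define \<nu>' where "\<nu>' = \<nu>(5 := p, 7 := u, 6 := q, 8 := w)"
  have mem: "p \<in> set (run l s) \<longleftrightarrow> l = 0 \<and> s = m" "u \<in> set (run l s) \<longleftrightarrow> l = 0 \<and> s = m"
    "q \<in> set (run l s) \<longleftrightarrow> l = k \<and> s = n" "w \<in> set (run l s) \<longleftrightarrow> l = k' \<and> s = r"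
    if "s \<le> length xs" "l \<le> 1" for l s
    using run_unique[OF p(1), of l s] run_unique[OF p(2), of l s] run_unique[OF p(3), of l s]
      run_unique[OF p(4), of l s] p m(1-3) k that by blast+
  have ne: "p \<noteq> q" "p \<noteq> w" "u \<noteq> q" "u \<noteq> w" "q \<noteq> w"
    using mem[OF m(1), of 0] mem[OF m(2) k(1)] mem[OF m(3) k(2)] p m(4-6) by blast+
  define F where "F = filter (\<lambda>v. v \<in> A) (run 0 m)"
  have setF: "set F = {p, u}"
    using mem[OF m(1), of 0] p(1,2) m(4,5) by (auto simp: F_def A_def)
  have distF: "distinct F" using run_distinct[OF m(1)] by (simp add: F_def)
  obtain l where l: "l \<in> {[5, 7], [7, 5], [5]}" "F = map \<nu>' l" "l = [5] \<longleftrightarrow> p = u"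
  proof (cases "p = u")
    case True
    then have "length F = 1" using setF distinct_card[OF distF] by simp
    then obtain a where F: "F = [a]" by (metis One_nat_def length_0_conv length_Suc_conv)
    then have "a = p" using setF by simp
    show ?thesis
    proof (rule that)
      show "F = map \<nu>' [5]" using F \<open>a = p\<close> by (simp add: \<nu>'_def)
    qed (use True in simp_all)
  next
    case False
    then have "length F = 2" using setF distinct_card[OF distF] by simp
    then obtain a b where F: "F = [a, b]"
      by (metis One_nat_def Suc_1 length_0_conv length_Suc_conv)
    then consider "a = p" "b = u" | "a = u" "b = p" using setF by (auto simp: doubleton_eq_iff)
    then show ?thesis
    proof cases
      case 1
      then have "F = map \<nu>' [5, 7]" using F by (simp add: \<nu>'_def)
      then show ?thesis by (rule that[rotated]) (use False in simp_all)
    next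
      case 2
      then have "F = map \<nu>' [7, 5]" using F by (simp add: \<nu>'_def)
      then show ?thesis by (rule that[rotated]) (use False in simp_all)
    qed
  qed
  define att :: attachment where "att = [((0, m), l), ((k, n), [6]), ((k', r), [8])]"
  \<comment> \<open>If both links start at the same vertex, node 7 does not occur and the second
    connector starts at node 5 too.\<close>
  define e :: nat where "e = (if l = [5] then 5 else 7)"
  have e: "\<nu>' e = u" "e \<in> set l" "e \<noteq> 8" "e \<noteq> 6" using l by (auto simp: e_def \<nu>'_def)
  have lab: "map \<nu>' xs = map \<nu> xs" "map \<nu>' ys = map \<nu> ys"
    using few_labels(1) same_labels(1) by (auto simp: \<nu>'_def)
  have att_l: "attached att 0 m = l" "attached att k n = [6]" "attached att k' r = [8]"
    using m by (auto simp: att_def attached_def)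
  have att: "filter (\<lambda>v. v \<in> A) (run i s) = map \<nu>' (attached att i s) \<and> length (attached att i s) \<le> 9"
    if i: "s \<le> length xs" "i \<le> 1" for i s
  proof (cases "i = 0 \<and> s = m")
    case True
    then show ?thesis using l att_l(1) by (auto simp: F_def)
  next
    case False
    have 1: "set (run i s) \<inter> A = set (map \<nu>' (attached att i s))"
      using mem[OF i] False m by (auto simp: A_def att_def attached_def \<nu>'_def)
    have 2: "length (map \<nu>' (attached att i s)) \<le> 1" using False by (auto simp: att_def attached_def)
    have 3: "distinct (map \<nu>' (attached att i s))" using False by (auto simp: att_def attached_def)
    show ?thesis
    proof
      show "length (attached att i s) \<le> 9" using 2 by simp
    qed (rule filter_run[OF i(1) 1 3 2])
  qed
  define U where "U = (\<Union>s\<le>length xs. set (attached att 0 s)) \<union> (\<Union>s\<le>length ys. set (attached att 1 s))"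
  have sub: "set (attached att i s) \<subseteq> U" if "i \<le> 1" "s \<le> length xs" for i s
  proof -
    have "i = 0 \<or> i = 1" using that(1) by auto
    then show ?thesis using that(2) same_labels(2) unfolding U_def by (elim disjE) auto
  qed
  have "set l \<union> {6, 8} \<subseteq> U"
    using sub[of 0 m] sub[OF k(1) m(2)] sub[OF k(2) m(3)] m(1) att_l by simp
  moreover have "set (attached att i s) \<subseteq> set l \<union> {6, 8}" for i s
    by (auto simp: attached_def att_def)
  then have "U \<subseteq> set l \<union> {6, 8}" unfolding U_def by blast
  ultimately have U: "U = set l \<union> {6, 8}" by blast
  have five: "5 \<in> set l" "\<nu>' 5 = p" "\<nu>' 6 = q" "\<nu>' 8 = w" using l(1) by (auto simp: \<nu>'_def)
  have "\<not> refuted xs ys att [(5, 6), (e, 8)] [] cert" for cert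
  proof (rule links_not_refuted[where \<nu> = \<nu>' and A = A and U = U and Rs = "[R, S]"])
    show "filter (\<lambda>v. v \<in> X) P = map \<nu>' xs" "filter (\<lambda>v. v \<in> X) Q = map \<nu>' ys"
      by (simp_all only: lab labels)
    show "set ys = set xs" "length xs \<le> 9" "length ys \<le> 9"
      using same_labels few_labels by simp_all
    show "filter (\<lambda>v. v \<in> A) (run 0 s) = map \<nu>' (attached att 0 s) \<and> length (attached att 0 s) \<le> 9"
      if "s \<le> length xs" for s using att[OF that, of 0] by blast
    show "filter (\<lambda>v. v \<in> A) (run 1 s) = map \<nu>' (attached att 1 s) \<and> length (attached att 1 s) \<le> 9"
      if "s \<le> length ys" for s using att[of s 1] that same_labels(2) by simp
    show "inj_on \<nu>' U"
      unfolding U using l(1,3) ne by (auto simp: \<nu>'_def inj_on_def)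
    show "a \<in> U \<and> b \<in> U \<and> a \<noteq> b \<and> link (\<nu>' a) ([R, S] ! i) (\<nu>' b)"
      if "i < length [(5, 6), (e, 8)]" "[(5, 6), (e, 8)] ! i = (a, b)" for i a b
    proof -
      have "i = 0 \<or> i = 1" using that(1) by auto
      then show ?thesis using that(2) links(1,2) five e U by auto
    qed
    show "set ([R, S] ! i) \<inter> set ([R, S] ! j) = {}"
      if "i < length [(5, 6), (e, 8)]" "j < length [(5, 6), (e, 8)]" "i \<noteq> j" for i j
      using that links(3) by (auto simp: less_Suc_eq)
  qed (simp_all add: U_def)
  then show ?thesis using that[OF l(1)] by (simp add: att_def e_def)
qed

end

section \<open>Links between paths that meet in the same order\<close>

locale identity_pair = labelled_pair E P Q N \<nu> identity identity
  for E :: "'a \<Rightarrow> 'a \<Rightarrow> bool" and P Q :: "'a list" and N :: nat and \<nu> :: "nat \<Rightarrow> 'a"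
begin

lemma link_far:
  assumes "k \<le> 1" "k' \<le> 1" "i \<le> 4" "j \<le> 4" "(k, i) \<noteq> (k', j)"
    and "p \<in> set (run k i)" "q \<in> set (run k' j)" "link p R q"
  shows "far i j"
proof -
  have *: "far i j" if "before (k, i) (k', j)" "k \<le> 1" "k' \<le> 1" "i \<le> 4" "j \<le> 4" "(k, i) \<noteq> (k', j)"
    "p \<in> set (run k i)" "q \<in> set (run k' j)" "link p R q" for k k' i j p q R
  proof (rule ccontr)
    assume "\<not> far i j"
    let ?l = "filter (\<lambda>(c, d). before c d \<and> \<not> far (snd c) (snd d)) (List.product (segments 4) (segments 4))"
    have "(k, i) \<in> set (segments 4)" "(k', j) \<in> set (segments 4)"
      using that(2-5) by (simp_all add: in_segments)
    then have mem: "((k, i), (k', j)) \<in> set ?l" using that(1) \<open>\<not> far i j\<close> by simp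
    obtain tab where "near_certified tab" using near_links by blast
    from list_all2_ex[OF this[unfolded near_certified_def] mem]
    obtain cert where "refuted identity identity [((k, i), [5]), ((k', j), [6])] [(5, 6)] [] cert"
      by (simp only: prod.case) blast
    then show False
      using single_link_not_refuted[OF refl refl that(2,3) _ _ that(6-9), of "[]" cert] that(4,5) by simp
  qed
  show ?thesis
  proof (cases "before (k, i) (k', j)")
    case True
    then show ?thesis by (rule *) fact+
  next
    case False
    then have "before (k', j) (k, i)" using assms(5) by (auto simp: before_def)
    then show ?thesis using *[OF _ assms(2,1,4,3) _ assms(7,6) link_sym[OF assms(8)]] assms(5) far_sym by metis
  qed
qed

text \<open>Links that meet combine to a link between the runs \<open>n\<close> and
  \<open>r\<close>, which would close a triangle in the pentagon; disjoint links are refuted by the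
  certificates.\<close>

lemma no_fork_0:
  assumes "m \<le> 4" "n \<le> 4" "r \<le> 4" "k \<le> 1" "k' \<le> 1" "far m n" "far m r" "n < r"
    and "p \<in> set (run 0 m)" "u \<in> set (run 0 m)" "q \<in> set (run k n)" "w \<in> set (run k' r)"
    and "link p R q" "link u S w"
  shows False
proof (cases "set R \<inter> set S = {}")
  case False
  obtain T where "link q T w" using link_combine[OF assms(13,14) False] .
  then have "far n r" using link_far[OF assms(4,5,2,3) _ assms(11,12)] assms(8) by blast
  then show False using far_no_triangle[OF assms(6,7)] assms by simp
next
  case True
  have ne: "m \<noteq> n" "m \<noteq> r" "n \<noteq> r" using assms by (auto simp: far_def)
  obtain l where l: "l \<in> {[5, 7], [7, 5], [5]}"
    and nr: "\<And>cert. \<not> refuted identity identity [((0, m), l), ((k, n), [6]), ((k', r), [8])]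
           [(5, 6), (if l = [5] then 5 else 7, 8)] [] cert"
    using two_links_not_refuted[of m n r k k' p u q w R S] assms ne True by auto
  let ?l = "List.product
         (filter (\<lambda>(m, n, r). far m n \<and> far m r \<and> n < r)
           (List.product [0..<5] (List.product [0..<5] [0..<5])))
         (List.product [0, 1] (List.product [0, 1] [[5, 7], [7, 5], [5 :: nat]]))"
  have "k = 0 \<or> k = 1" "k' = 0 \<or> k' = 1" using assms(4,5) by auto
  then have mem: "((m, n, r), k, k', l) \<in> set ?l" using assms(1-3,6-8) l by auto
  obtain tab where "forks_certified tab" using forks by blast
  from list_all2_ex[OF this[unfolded forks_certified_def] mem] show False
    using nr by (simp only: prod.case) blast
qed

end

lemma identity_pair_swap:
  assumes "identity_pair E P Q N \<nu>" shows "identity_pair E Q P N \<nu>"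
proof -
  interpret identity_pair E P Q N \<nu> by fact
  have "labelled_pair E Q P N \<nu> identity identity"
    by (rule labelled_pair_swap) (rule labelled_pair_axioms)
  then show ?thesis
    by (rule identity_pair.intro)
qed

context identity_pair
begin

lemma no_fork:
  assumes "m \<le> 4" "n \<le> 4" "r \<le> 4" "l \<le> 1" "k \<le> 1" "k' \<le> 1" "far m n" "far m r"
    and "p \<in> set (run l m)" "u \<in> set (run l m)" "q \<in> set (run k n)" "w \<in> set (run k' r)"
    and "link p R q" "link u S w"
  shows "n = r"
proof (rule ccontr)
  assume "n \<noteq> r"
  interpret sw: identity_pair E Q P N \<nu> by (rule identity_pair_swap) unfold_locales
  have *: False if "m \<le> 4" "n \<le> 4" "r \<le> 4" "k \<le> 1" "k' \<le> 1" "far m n" "far m r" "n < r"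
    "p \<in> set (run l m)" "u \<in> set (run l m)" "q \<in> set (run k n)" "w \<in> set (run k' r)"
    "link p R q" "link u S w"
    for n r k k' p u q w R S
  proof (cases "l = 0")
    case True
    show False by (rule no_fork_0[OF that(1-8) _ _ that(11-14)]) (use that(9,10) True in simp_all)
  next
    case False
    then have "l = 1" using assms(4) by simp
    \<comment> \<open>A fork at a run of \<open>Q\<close> becomes a fork at a run of the first path
      after the exchange, where run \<open>(k, s)\<close> has index
      \<open>(1 - k, s)\<close>.\<close>
    then have "sw.run 0 m = run l m" using swapped_run[of 1 m] by simp
    then have "p \<in> set (sw.run 0 m)" "u \<in> set (sw.run 0 m)"
      "q \<in> set (sw.run (1 - k) n)" "w \<in> set (sw.run (1 - k') r)"
      "sw.link p R q" "sw.link u S w"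
      using that(9-14) swapped_run[OF that(4), of n] swapped_run[OF that(5), of r] swapped_link by simp_all
    then show False
      by (rule sw.no_fork_0[OF that(1-3) diff_le_self diff_le_self that(6-8)])
  qed
  show False
  proof (cases "n < r")
    case True
    then show False by (rule *[OF assms(1-3,5-8) _ assms(9-14)])
  next
    case False
    then have "r < n" using \<open>n \<noteq> r\<close> by simp
    then show False
      by (rule *[OF assms(1,3,2,6,5,8,7) _ assms(10,9,12,11,14,13)])
  qed
qed

text \<open>Without forks, links starting from the runs \<open>m\<close> and \<open>n\<close> lead
  back to runs with these two indices. By connectedness all other runs are empty, which is the
  situation of \<open>far_certified\<close>.\<close>

lemma identity_impossible: False
proof -
  have four: "length identity = 4" by simp
  note in_run_0 = in_run_0[unfolded four] and in_run_1 = in_run_1[unfolded four] and in_run = in_run[unfolded four]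
  obtain p0 q0 where "p0 \<in> set P - X" "q0 \<in> set P \<union> set Q - X" "q0 \<notin> set P - X" using proper by auto
  then obtain p R q where pq: "p \<in> set P - X" "q \<in> set P \<union> set Q - X - (set P - X)" "link p R q"
    by (rule ex_link[rotated]) auto
  obtain m where m: "m \<le> 4" "p \<in> set (run 0 m)" using pq(1) in_run_0 by blast
  obtain n where n: "n \<le> 4" "q \<in> set (run 1 n)" using pq(2) in_run_1[of q] by blast
  have mn: "far m n" using link_far[OF _ _ m(1) n(1) _ m(2) n(2) pq(3)] by simp
  define joins where "joins k s s' \<longleftrightarrow>
    (\<exists>x\<in>set (run k s). \<exists>k'\<le>1. \<exists>y\<in>set (run k' s'). \<exists>T. link x T y)" for k s s'
  define other where "other s = (if s = m then n else m)" for s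
  \<comment> \<open>\<open>U\<close> is a union of whole runs. Requiring \<open>joins\<close> makes
    sure that each of them already has a link to the other index, which \<open>no_fork\<close>
    compares with any further link.\<close>
  define U where "U = {v. \<exists>k\<le>1. \<exists>s\<in>{m, n}. v \<in> set (run k s) \<and> joins k s (other s)}"
  have nm: "n \<noteq> m" using mn by (auto simp: far_def)
  have pU: "p \<in> U"
  proof -
    have "joins 0 m n" using m(2) n(2) pq(3) unfolding joins_def by (meson order_refl)
    then show ?thesis using m(2) by (auto simp: U_def other_def)
  qed
  have "v \<in> U" if v: "v \<in> set P \<union> set Q - X" for v
  proof (rule ccontr)
    assume "v \<notin> U"
    have "U \<subseteq> set P \<union> set Q - X"
    proof
      fix x assume "x \<in> U"
      then obtain k s where "k \<le> 1" "s \<in> {m, n}" "x \<in> set (run k s)" unfolding U_def by blast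
      moreover from this have "s \<le> 4" using m(1) n(1) by blast
      ultimately show "x \<in> set P \<union> set Q - X" using in_run by blast
    qed
    then obtain x T y where xy: "x \<in> U" "y \<in> set P \<union> set Q - X - U" "link x T y"
      using ex_link[OF _ pU v \<open>v \<notin> U\<close>] by metis
    obtain k s where s: "k \<le> 1" "s \<in> {m, n}" "x \<in> set (run k s)" "joins k s (other s)"
      using xy(1) unfolding U_def by blast
    obtain k' s' where s': "k' \<le> 1" "s' \<le> 4" "y \<in> set (run k' s')" using xy(2) in_run[of y] by auto
    obtain x' l y' T' where j: "x' \<in> set (run k s)" "l \<le> 1" "y' \<in> set (run l (other s))" "link x' T' y'"
      using s(4) unfolding joins_def by blast
    have s4: "s \<le> 4" "other s \<le> 4" "far s (other s)"
      using s(2) m(1) n(1) mn far_sym by (auto simp: other_def)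
    have "(k, s) \<noteq> (k', s')" using xy(1,2) s s' unfolding U_def by blast
    then have "far s s'" using link_far[OF s(1) s'(1) s4(1) s'(2) _ s(3) s'(3) xy(3)] by blast
    \<comment> \<open>A link leaving \<open>U\<close> and the known link from the same run would
      otherwise be a fork.\<close>
    then have "s' = other s"
      using no_fork[OF s4(1) s'(2) s4(2) s(1) s'(1) j(2) _ s4(3) s(3) j(1) s'(3) j(3) xy(3) j(4)] by blast
    moreover from this have "other s' = s" "s' \<in> {m, n}" using s(2) nm by (auto simp: other_def)
    moreover have "joins k' s' s" using s(1,3) s'(3) link_sym[OF xy(3)] unfolding joins_def by blast
    ultimately have "joins k' s' (other s')" by simp
    then have "y \<in> U" using s'(1,3) \<open>s' \<in> {m, n}\<close> unfolding U_def by blast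
    then show False using xy(2) by simp
  qed
  then have "set P \<union> set Q - X \<subseteq> U" by blast
  have empty: "run k s = []" if ks: "k \<le> 1" "s \<le> 4" "s \<noteq> m" "s \<noteq> n" for k s
  proof (rule ccontr)
    assume "run k s \<noteq> []"
    then obtain v where v: "v \<in> set (run k s)" by (cases "run k s") auto
    then have "v \<in> set P \<union> set Q - X" using in_run[of v] ks(1,2) by blast
    then have "v \<in> U" using \<open>set P \<union> set Q - X \<subseteq> U\<close> by blast
    then obtain k' s' where s': "k' \<le> 1" "s' \<in> {m, n}" "v \<in> set (run k' s')" unfolding U_def by blast
    then have "s' \<le> 4" using m(1) n(1) by blast
    then show False
      using run_unique[OF v s'(3) ks(1) s'(1), unfolded four] ks(2-4) s'(2) by blast
  qed
  let ?emp = "filter (\<lambda>e. snd e \<noteq> m \<and> snd e \<noteq> n) (segments 4)"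
  have mem: "(m, n) \<in> set (filter (\<lambda>(m, n). far m n) (List.product [0..<5] [0..<5]))"
    using m(1) n(1) mn by simp
  obtain tab where "far_certified tab" using far_links by blast
  from list_all2_ex[OF this[unfolded far_certified_def] mem]
  obtain cert where "refuted identity identity [((0, m), [5]), ((1, n), [6])] [(5, 6)] ?emp cert"
    by (simp only: prod.case) blast
  moreover have "\<not> refuted identity identity [((0, m), [5]), ((1, n), [6])] [(5, 6)] ?emp cert"
  proof (rule single_link_not_refuted[OF refl refl _ _ _ _ _ m(2) n(2) pq(3)])
    fix k s assume "(k, s) \<in> set ?emp"
    then have "k \<le> 1" "s \<le> 4" "s \<noteq> m" "s \<noteq> n"
      by (simp_all add: in_segments)
    then show "k \<le> 1 \<and> s \<le> 9 \<and> run k s = []" using empty by simp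
  qed (use m(1) n(1) in simp_all)
  ultimately show False by blast
qed

end

section \<open>The order of the common vertices\<close>

text \<open>The paths are quantified away so that the statement depends only on the two orders of
  the common vertices and can be transformed by reversal and exchange.\<close>

definition crosses :: "('a \<Rightarrow> 'a \<Rightarrow> bool) \<Rightarrow> nat \<Rightarrow> 'a list \<Rightarrow> 'a list \<Rightarrow> bool" where
  "crosses E N as bs \<longleftrightarrow> (\<exists>P Q. longest_pair E P Q N \<and>
     filter (\<lambda>v. v \<in> set P \<inter> set Q) P = as \<and> filter (\<lambda>v. v \<in> set P \<inter> set Q) Q = bs)"

lemma crosses_swap:
  assumes "crosses E N as bs" shows "crosses E N bs as"
proof -
  obtain P Q where "longest_pair E P Q N"
    "filter (\<lambda>v. v \<in> set P \<inter> set Q) P = as" "filter (\<lambda>v. v \<in> set P \<inter> set Q) Q = bs"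
    using assms unfolding crosses_def by blast
  then have "longest_pair E Q P N"
    "filter (\<lambda>v. v \<in> set Q \<inter> set P) Q = bs" "filter (\<lambda>v. v \<in> set Q \<inter> set P) P = as"
    using longest_pair_swap by (simp_all add: Int_commute)
  then show ?thesis unfolding crosses_def by blast
qed

lemma crosses_rev:
  assumes "crosses E N as bs" shows "crosses E N (rev as) bs"
proof -
  obtain P Q where pq: "longest_pair E P Q N"
    "filter (\<lambda>v. v \<in> set P \<inter> set Q) P = as" "filter (\<lambda>v. v \<in> set P \<inter> set Q) Q = bs"
    using assms unfolding crosses_def by blast
  interpret longest_pair E P Q N by fact
  have "successively E (rev P)"
    unfolding successively_rev by (rule successively_mono[OF walks(1)]) (rule sym)
  then have "longest_pair E (rev P) Q N"
    using sym walks distinct_paths lengths maximal joined proper by unfold_locales auto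
  moreover have "filter (\<lambda>v. v \<in> set (rev P) \<inter> set Q) (rev P) = rev as"
    unfolding pq(2)[symmetric] rev_filter set_rev ..
  moreover have "filter (\<lambda>v. v \<in> set (rev P) \<inter> set Q) Q = bs" using pq(3) by simp
  ultimately show ?thesis unfolding crosses_def by blast
qed

lemma crosses_symmetries:
  assumes "crosses E N as bs"
  shows "crosses E N (rev as) bs" "crosses E N as (rev bs)" "crosses E N (rev as) (rev bs)"
    "crosses E N bs as" "crosses E N (rev bs) as" "crosses E N bs (rev as)" "crosses E N (rev bs) (rev as)"
  using assms by (blast intro: crosses_swap crosses_rev)+

text \<open>Each common vertex is numbered by its position among the common vertices of
  \<open>P\<close>; then only the order on \<open>Q\<close> varies.\<close>

lemma crosses_labelled:
  assumes "crosses E N as (map ((!) as) ys)" "set ys = {..<length as}" "length ys = length as" "length as \<le> 4"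
  shows "\<exists>P Q. labelled_pair E P Q N ((!) as) [0..<length as] ys"
proof -
  obtain P Q where pq: "longest_pair E P Q N" "filter (\<lambda>v. v \<in> set P \<inter> set Q) P = as"
    "filter (\<lambda>v. v \<in> set P \<inter> set Q) Q = map ((!) as) ys"
    using assms(1) unfolding crosses_def by blast
  have "labelled_pair_axioms P Q ((!) as) [0..<length as] ys"
  proof
    show "filter (\<lambda>v. v \<in> set P \<inter> set Q) P = map ((!) as) [0..<length as]"
      unfolding pq(2) map_nth ..
  qed (use pq(3) assms(2-4) in \<open>simp_all only: set_upt length_upt atLeast0LessThan diff_zero, simp_all\<close>)
  then have "labelled_pair E P Q N ((!) as) [0..<length as] ys"
    by (rule labelled_pair.intro[OF pq(1)])
  then show ?thesis by blast
qed

lemma not_crosses_if_separation: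
  assumes "\<exists>tab. separation xs ys lab tab" "xs = [0..<length as]" "bs = map ((!) as) ys"
    and "set ys = set xs" "length ys = length as" "length as \<le> 4"
  shows "\<not> crosses E N as bs"
proof
  assume crosses: "crosses E N as bs"
  obtain tab where tab: "separation xs ys lab tab" using assms(1) ..
  have "set ys = {..<length as}"
    unfolding assms(4) assms(2) by (simp add: lessThan_atLeast0)
  from crosses_labelled[OF crosses[unfolded assms(3)] this assms(5,6)]
  obtain P Q where "labelled_pair E P Q N ((!) as) xs ys" unfolding assms(2) by (elim exE)
  from labelled_pair.separation_impossible[OF this] tab show False by (rule notE)
qed

lemma not_crosses_identity: "\<not> crosses E N [a, b, c, d] [a, b, c, d]"
proof
  assume crosses: "crosses E N [a, b, c, d] [a, b, c, d]"
  have "map ((!) [a, b, c, d]) identity = [a, b, c, d]" "set identity = {..<length [a, b, c, d]}"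
    "[0..<length [a, b, c, d]] = identity" by (auto simp: upt_rec)
  then have "\<exists>P Q. labelled_pair E P Q N ((!) [a, b, c, d]) identity identity"
    using crosses_labelled[of E N "[a, b, c, d]" identity] crosses
    by (simp only: list.size)
  then obtain P Q where "labelled_pair E P Q N ((!) [a, b, c, d]) identity identity"
    by blast
  then have "identity_pair E P Q N ((!) [a, b, c, d])"
    by (rule identity_pair.intro)
  then show False by (rule identity_pair.identity_impossible)
qed

lemma not_crosses_small:
  "\<not> crosses E N [] []"
  "\<not> crosses E N [a] [a]"
  "\<not> crosses E N [a, b] [a, b]"
  "\<not> crosses E N [a, b, c] [a, b, c]"
  "\<not> crosses E N [a, b, c] [a, c, b]"
  by (rule not_crosses_if_separation[OF separation_Nil]
      not_crosses_if_separation[OF separation_0]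
      not_crosses_if_separation[OF separation_01]
      not_crosses_if_separation[OF separation_012]
      not_crosses_if_separation[OF separation_021]; auto simp: upt_rec)+

text \<open>Reversing either path and exchanging the paths group the 24 orders of four vertices into
  seven classes; these are representatives of the six classes other than that of the
  identity.\<close>

lemma not_crosses_four:
  "\<not> crosses E N [a, b, c, d] [a, b, d, c]"
  "\<not> crosses E N [a, b, c, d] [a, c, b, d]"
  "\<not> crosses E N [a, b, c, d] [a, c, d, b]"
  "\<not> crosses E N [a, b, c, d] [a, d, c, b]"
  "\<not> crosses E N [a, b, c, d] [b, a, d, c]"
  "\<not> crosses E N [a, b, c, d] [b, d, a, c]"
  by (rule not_crosses_if_separation[OF separation_0132]
      not_crosses_if_separation[OF separation_0213]
      not_crosses_if_separation[OF separation_0231]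
      not_crosses_if_separation[OF separation_0321]
      not_crosses_if_separation[OF separation_1032]
      not_crosses_if_separation[OF separation_1302]; auto simp: upt_rec)+

lemma not_crosses_at_most_four:
  assumes "crosses E N as bs" "distinct as" "distinct bs" "set as = set bs" "length as \<le> 4"
  shows False
proof -
  have len: "length bs = length as" using assms(2-4) distinct_card by metis
  note sym = crosses_symmetries[OF assms(1)]
  consider "length as = 0" | "length as = 1" | "length as = 2" | "length as = 3" | "length as = 4"
    using assms(5) by linarith
  then show False
  proof cases
    case 1
    then show False using assms(1) len by (simp add: not_crosses_small)
  next
    case 2
    then obtain a b where "as = [a]" "bs = [b]" using len by (auto simp: length_Suc_conv)
    then show False using assms by (simp add: not_crosses_small)
  next
    case 3
    then obtain a b e f where "as = [a, b]" "bs = [e, f]"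
      using len by (auto simp: length_Suc_conv numeral_eq_Suc)
    moreover from this have "e = a \<and> f = b \<or> e = b \<and> f = a" using assms(2-4) by auto
    ultimately show False using assms(1) sym(2) by (elim disjE conjE) (simp_all add: not_crosses_small)
  next
    case 4
    then obtain a b c e f g where eq: "as = [a, b, c]" "bs = [e, f, g]"
      using len by (auto simp: length_Suc_conv numeral_eq_Suc)
    then have "e \<in> {a, b, c}" "f \<in> {a, b, c}" "g \<in> {a, b, c}" using assms(4) by auto
    then show False
      using assms(1,2,3) sym unfolding eq
      by (elim insertE emptyE) (simp_all add: not_crosses_small)
  next
    case 5
    then obtain a b c d e f g h where eq: "as = [a, b, c, d]" "bs = [e, f, g, h]"
      using len by (auto simp: length_Suc_conv numeral_eq_Suc)
    \<comment> \<open>All 256 assignments are tried: those with repetitions contradict distinctness,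
      and the others are carried to a representative by one of the symmetries.\<close>
    then have "e \<in> {a, b, c, d}" "f \<in> {a, b, c, d}" "g \<in> {a, b, c, d}" "h \<in> {a, b, c, d}"
      using assms(4) by auto
    then show False
      using assms(1,2,3) sym unfolding eq
      by (elim insertE emptyE) (simp_all add: not_crosses_four not_crosses_identity)
  qed
qed

section \<open>Translation from the digraph\<close>

lemma vwalk_arcs_subset_iff:
  "set (vwalk_arcs p) \<subseteq> A \<longleftrightarrow> successively (\<lambda>u v. (u, v) \<in> A) p"
  by (induction p rule: vwalk_arcs.induct) auto

lemma vpath_iff:
  "vpath p G \<longleftrightarrow> p \<noteq> [] \<and> distinct p \<and> set p \<subseteq> verts G \<and> successively (\<lambda>u v. u \<rightarrow>\<^bsub>G\<^esub> v) p"
  by (auto simp: vpath_def vwalk_def vwalk_arcs_subset_iff)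

lemma (in wf_digraph) successively_verts:
  "successively (\<lambda>u v. u \<rightarrow>\<^bsub>G\<^esub> v) (x # y # w) \<Longrightarrow> set (x # y # w) \<subseteq> verts G"
  by (induction w arbitrary: x y) (auto dest: adj_in_verts)

text \<open>\<open>connected\<close> ignores the direction of arcs. As the induced subgraph is
  symmetric, it is even strongly connected, so a directed path exists.\<close>

lemma k_connected_vpath:
  assumes "graph G" "k_connected k G" "S \<subseteq> verts G" "card S < k" "u \<in> verts G - S" "v \<in> verts G - S"
  obtains p where "vpath p G" "hd p = u" "last p = v" "set p \<inter> S = {}"
proof -
  interpret graph G by fact
  let ?H = "G \<restriction> (verts G - S)"
  interpret H: wf_digraph ?H by (rule wellformed_induce_subgraph)
  have sub: "subgraph ?H G" by (rule induced_imp_subgraph) (rule induced_induce, simp)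
  have "symmetric ?H"
    using sym_arcs unfolding symmetric_conv by fastforce
  moreover have "connected ?H" using assms(2-4) unfolding k_connected_def by blast
  ultimately have "strongly_connected ?H" by (rule H.symmetric_connected_imp_strongly_connected)
  then have "u \<rightarrow>\<^sup>*\<^bsub>?H\<^esub> v" using assms(5,6) by (auto simp: strongly_connected_def)
  then obtain p where p: "vpath p ?H" "hd p = u" "last p = v"
    using H.reachable_vpath_conv by blast
  moreover have "set p \<inter> S = {}" using p(1) by (auto simp: vpath_iff)
  ultimately show ?thesis using that vpathI_subgraph[OF p(1) sub] by blast
qed

text \<open>A path with fewer than \<open>k\<close> vertices can be prolonged at its first vertex, as the other
  vertices do not separate that vertex from the rest of the graph.\<close>

lemma longest_path_length:
  assumes "graph G" "k_connected k G" "longest_path G p"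
  shows "k \<le> length p"
proof (rule ccontr)
  assume short: "\<not> k \<le> length p"
  interpret graph G by fact
  have p: "vpath p G" and longest: "\<And>q. vpath q G \<Longrightarrow> length q - 1 \<le> length p - 1"
    using assms(3) by (auto simp: longest_path_def)
  obtain x ps where xp: "p = x # ps" using p by (cases p) (auto simp: vpath_iff)
  have card: "card (set p) = length p" "card (set ps) = length ps"
    using p xp by (auto simp: vpath_iff distinct_card)
  have "\<not> verts G \<subseteq> set p"
    using assms(2) short card(1) card_mono[of "set p" "verts G"] by (auto simp: k_connected_def)
  then obtain y where y: "y \<in> verts G" "y \<notin> set p" by blast
  obtain q where q: "vpath q G" "hd q = x" "last q = y" "set q \<inter> set ps = {}"
    using k_connected_vpath[OF assms(1,2), of "set ps" x y] p xp y short card(2)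
    by (auto simp: vpath_iff)
  \<comment> \<open>Since \<open>y\<close> is not on \<open>p\<close>, the path \<open>q\<close> has
    a second vertex \<open>z\<close>. It differs from \<open>x\<close> and avoids \<open>ps\<close>,
    so it is new.\<close>
  then obtain z qs where zq: "q = x # z # qs"
    using y(2) xp by (cases q rule: vwalk_arcs.cases) (auto simp: vpath_iff)
  have "vpath (z # p) G"
    using p q xp zq arcs_ends_symmetric[OF sym_arcs] by (auto simp: vpath_iff)
  then show False using longest[of "z # p"] xp by simp
qed

theorem theorem1p3:
  fixes G :: "('a, 'b) pre_digraph" and P Q :: "'a vwalk"
  assumes "graph G"
    and "k_connected 5 G"
    and "longest_path G P"
    and "longest_path G Q"
  shows "card (set P \<inter> set Q) \<ge> 5"
proof (rule ccontr)
  assume "\<not> card (set P \<inter> set Q) \<ge> 5"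
  then have few: "card (set P \<inter> set Q) < 5" by simp
  interpret graph G by fact
  let ?E = "\<lambda>u v. u \<rightarrow>\<^bsub>G\<^esub> v" and ?X = "set P \<inter> set Q"
  have paths: "vpath P G" "vpath Q G"
    and longest: "\<And>q. vpath q G \<Longrightarrow> length q - 1 \<le> length P - 1"
      "\<And>q. vpath q G \<Longrightarrow> length q - 1 \<le> length Q - 1"
    using assms(3,4) by (auto simp: longest_path_def)
  note [simp] = distinct_card
  have long: "5 \<le> length P" "5 \<le> length Q"
    using longest_path_length assms by blast+
  have len: "length Q = length P"
    using longest(1)[OF paths(2)] longest(2)[OF paths(1)] long by linarith
  have dist: "distinct P" "distinct Q" and walks: "successively ?E P" "successively ?E Q"
    and verts: "set P \<subseteq> verts G" "set Q \<subseteq> verts G"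
    using paths by (auto simp: vpath_iff)
  have "longest_pair ?E P Q (length P)"
  proof
    show "v \<rightarrow>\<^bsub>G\<^esub> u" if "u \<rightarrow>\<^bsub>G\<^esub> v" for u v
      using arcs_ends_symmetric[OF sym_arcs that] .
    show "length w \<le> length P" if w: "successively ?E w" "distinct w" for w
    \<comment> \<open>A list with fewer than two vertices is a walk for trivial reasons, even
      outside the graph; it is short enough because \<open>P\<close> has at least five
      vertices.\<close>
    proof (cases w rule: vwalk_arcs.cases)
      case (3 x y v)
      then have "vpath w G" using w successively_verts by (simp add: vpath_iff)
      then show ?thesis using longest(1) long by fastforce
    qed (use long in simp_all)
    show "\<exists>w. w \<noteq> [] \<and> distinct w \<and> successively ?E w \<and> hd w = u \<and> last w = v \<and> set w \<inter> ?X = {}"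
      if "u \<in> set P \<union> set Q - ?X" "v \<in> set P \<union> set Q - ?X" for u v
    proof -
      have "u \<in> verts G - ?X" "v \<in> verts G - ?X" "?X \<subseteq> verts G" using that verts by auto
      then obtain w where "vpath w G" "hd w = u" "last w = v" "set w \<inter> ?X = {}"
        using k_connected_vpath[OF assms(1,2) _ few] by blast
      then show ?thesis by (auto simp: vpath_iff)
    qed
    \<comment> \<open>Each path has at least five vertices, of which at most four are
      common.\<close>
    have "\<not> set P \<subseteq> ?X" "\<not> set Q \<subseteq> ?X"
      using few long dist card_mono[of ?X "set P"] card_mono[of ?X "set Q"] by auto
    then show "set P - set Q \<noteq> {}" "set Q - set P \<noteq> {}" by auto
  qed (simp_all add: dist walks len)
  then have "crosses ?E (length P) (filter (\<lambda>v. v \<in> ?X) P) (filter (\<lambda>v. v \<in> ?X) Q)"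
    unfolding crosses_def by blast
  moreover have "set (filter (\<lambda>v. v \<in> ?X) P) = ?X" "set (filter (\<lambda>v. v \<in> ?X) Q) = ?X" by auto
  moreover from this have "length (filter (\<lambda>v. v \<in> ?X) P) \<le> 4"
    using few dist distinct_card[of "filter (\<lambda>v. v \<in> ?X) P"] by simp
  ultimately show False
    using not_crosses_at_most_four dist by (metis distinct_filter)
qed

end
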